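(* Let $K$ be any field, let $\kappa$ be any ordinal with uncountable cofinality, and let $E_\kappa$ be the graph with vertices the ordinals less than $\kappa$ (defined in the context). Then the $K$-algebra unitization $\widehat{L_K(E_\kappa)}$ is a unital, prime, non-primitive, von Neumann regular ring. In particular, let $\{\kappa_\alpha\mid\alpha\in\mathcal{A}\}$ be a collection of uncountable ordinals, each of uncountable cofinality, and each of different cardinality. Then the collection $\{\widehat{L_{\mathbb{C}}(E_{\kappa_\alpha})}\mid\alpha\in\mathcal{A}\}$ consists of pairwise nonisomorphic, unital, prime, non-primitive, von Neumann regular $\mathbb{C}$-algebras.
   Context: A (directed) graph $E=(E^0,E^1,r,s)$ consists of sets $E^0$ (vertices), $E^1$ (edges), of arbitrary cardinality, and functions $r,s:E^1\to E^0$ (range and source). For an ordinal $\kappa$, the graph $E_\kappa$ has vertex set $\{\alpha\mid\alpha<\kappa\}$ and edge set $\{e_{\alpha,\beta}\mid\alpha,\beta<\kappa,\ \alpha<\beta\}$, with $s(e_{\alpha,\beta})=\alpha$ and $r(e_{\alpha,\beta})=\beta$. An ordinal $\kappa$ has countable cofinality if there is an at most countable set $C$ of ordinals strictly less than $\kappa$ such that every $\alpha<\kappa$ satisfies $\alpha\le\beta$ for some $\beta\in C$ (so in particular every countable ordinal and every successor ordinal has countable cofinality); otherwise $\kappa$ has uncountable cofinality. The Leavitt path algebra $L_K(E)$ is the (associative, not necessarily unital) $K$-algebra generated by the set $\{v\mid v\in E^0\}\cup\{e,e^*\mid e\in E^1\}$ subject to the relations: (V) $vw=\delta_{v,w}v$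 for $v,w\in E^0$; (E1) $s(e)e=er(e)=e$ for $e\in E^1$; (E2) $r(e)e^*=e^*s(e)=e^*$ for $e\in E^1$; (CK1) $e^*e'=\delta_{e,e'}r(e)$ for $e,e'\in E^1$; (CK2) $v=\sum_{\{e\in E^1\mid s(e)=v\}}ee^*$ for every vertex $v$ with $1\le|s^{-1}(v)|<\infty$. For a $K$-algebra $R$ (not necessarily unital), the $K$-algebra unitization of $R$ is $\widehat{R}=K\oplus R$ with coordinatewise addition and $K$-scalar action and multiplication $(k,r)\cdot(l,s)=(kl,ks+lr+rs)$; it has identity $(1,0)$. A ring $R$ (possibly nonunital) is prime if the product of any two nonzero two-sided ideals is nonzero; (left) primitive if it admits a simple faithful left $R$-module; von Neumann regular if for each $a\in R$ there is $x\in R$ with $a=axa$. *)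

theory Defs
  imports
    Complex_Main
    "HOL-Library.Countable_Set"
    "HOL-Library.Equipollence"
    "HOL-Library.Poly_Mapping"
    "HOL-Algebra.Module"
    "HOL-Algebra.QuotRing"
    "HOL-Algebra.Ideal_Product"
    "Graph_Theory.Digraph"
begin

section \<open>Ordinals and the graphs attached to them\<close>

text \<open>
  An ordinal is represented by a well-order relation \<open>\<kappa>\<close> in the sense of \<^const>\<open>Well_order\<close>:
  the ordinals below it are the elements of \<open>Field \<kappa>\<close>, and \<open>(\<alpha>, \<beta>) \<in> \<kappa>\<close> means \<open>\<alpha> \<le> \<beta>\<close>.
\<close>

definition countable_cofinality :: "'a rel \<Rightarrow> bool" where
  "countable_cofinality \<kappa> \<longleftrightarrow>
     (\<exists>C. C \<subseteq> Field \<kappa> \<and> countable C \<and> (\<forall>\<alpha>\<in>Field \<kappa>. \<exists>\<beta>\<in>C. (\<alpha>, \<beta>) \<in> \<kappa>))"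

abbreviation uncountable_cofinality :: "'a rel \<Rightarrow> bool" where
  "uncountable_cofinality \<kappa> \<equiv> \<not> countable_cofinality \<kappa>"

text \<open>The edge from \<open>\<alpha>\<close> to \<open>\<beta>\<close> is the pair \<open>(\<alpha>, \<beta>)\<close>; in \<^typ>\<open>('a, 'b) pre_digraph\<close> the source of
  an edge is its tail and the range is its head.\<close>

definition ordinal_graph :: "'a rel \<Rightarrow> ('a, 'a \<times> 'a) pre_digraph" where
  "ordinal_graph \<kappa> =
     \<lparr>verts = Field \<kappa>, arcs = {(\<alpha>, \<beta>). (\<alpha>, \<beta>) \<in> \<kappa> \<and> \<alpha> \<noteq> \<beta>}, tail = fst, head = snd\<rparr>"


section \<open>Algebras over a field\<close>

text \<open>
  The scalars form a type of class \<^class>\<open>field\<close>, and a (possibly nonunital) algebra is a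
  \<^typ>\<open>('k, 'b) module\<close> record. For the nonunital algebras below (free algebra, quotients,
  Leavitt path algebras) the record field \<open>one\<close> is \<open>undefined\<close> and is never used.
\<close>

locale unital_algebra = ring A for A :: "('k::field, 'b) module" (structure) +
  assumes smult_closed: "x \<in> carrier A \<Longrightarrow> k \<odot> x \<in> carrier A"
    and smult_l_distr: "x \<in> carrier A \<Longrightarrow> (k + l) \<odot> x = k \<odot> x \<oplus> l \<odot> x"
    and smult_r_distr: "\<lbrakk>x \<in> carrier A; y \<in> carrier A\<rbrakk> \<Longrightarrow> k \<odot> (x \<oplus> y) = k \<odot> x \<oplus> k \<odot> y"
    and smult_assoc: "x \<in> carrier A \<Longrightarrow> (k * l) \<odot> x = k \<odot> (l \<odot> x)"
    and smult_one: "x \<in> carrier A \<Longrightarrow> 1 \<odot> x = x"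
    and smult_mult_l: "\<lbrakk>x \<in> carrier A; y \<in> carrier A\<rbrakk> \<Longrightarrow> (k \<odot> x) \<otimes> y = k \<odot> (x \<otimes> y)"
    and smult_mult_r: "\<lbrakk>x \<in> carrier A; y \<in> carrier A\<rbrakk> \<Longrightarrow> x \<otimes> (k \<odot> y) = k \<odot> (x \<otimes> y)"

definition algebra_isomorphic :: "('k, 'a) module \<Rightarrow> ('k, 'b) module \<Rightarrow> bool" where
  "algebra_isomorphic A B \<longleftrightarrow>
     (\<exists>h\<in>ring_iso A B. \<forall>k. \<forall>x\<in>carrier A. h (k \<odot>\<^bsub>A\<^esub> x) = k \<odot>\<^bsub>B\<^esub> h x)"

definition unitization :: "('k::field, 'b) module \<Rightarrow> ('k, 'k \<times> 'b) module" where
  "unitization A =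
     \<lparr>carrier = UNIV \<times> carrier A,
      monoid.mult = (\<lambda>(k, r) (l, s). (k * l, (k \<odot>\<^bsub>A\<^esub> s \<oplus>\<^bsub>A\<^esub> l \<odot>\<^bsub>A\<^esub> r) \<oplus>\<^bsub>A\<^esub> r \<otimes>\<^bsub>A\<^esub> s)),
      one = (1, \<zero>\<^bsub>A\<^esub>),
      zero = (0, \<zero>\<^bsub>A\<^esub>),
      add = (\<lambda>(k, r) (l, s). (k + l, r \<oplus>\<^bsub>A\<^esub> s)),
      smult = (\<lambda>c (k, r). (c * k, c \<odot>\<^bsub>A\<^esub> r))\<rparr>"

text \<open>The two-sided algebra ideal generated by a set \<open>S\<close>; negatives come from \<open>smult\<close>.\<close>

inductive_set generated_ideal :: "('k::field, 'b) module \<Rightarrow> 'b set \<Rightarrow> 'b set"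
  for A (structure) and S where
  generator: "x \<in> S \<Longrightarrow> x \<in> generated_ideal A S"
| zero: "\<zero> \<in> generated_ideal A S"
| add: "\<lbrakk>x \<in> generated_ideal A S; y \<in> generated_ideal A S\<rbrakk> \<Longrightarrow> x \<oplus> y \<in> generated_ideal A S"
| smult: "x \<in> generated_ideal A S \<Longrightarrow> k \<odot> x \<in> generated_ideal A S"
| mult_l: "\<lbrakk>a \<in> carrier A; x \<in> generated_ideal A S\<rbrakk> \<Longrightarrow> a \<otimes> x \<in> generated_ideal A S"
| mult_r: "\<lbrakk>a \<in> carrier A; x \<in> generated_ideal A S\<rbrakk> \<Longrightarrow> x \<otimes> a \<in> generated_ideal A S"

text \<open>The same operations on cosets as in \<^const>\<open>FactRing\<close>, with a scalar action and without unit.\<close>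

definition quotient_algebra :: "('k::field, 'b) module \<Rightarrow> 'b set \<Rightarrow> ('k, 'b set) module" where
  "quotient_algebra A I =
     \<lparr>carrier = a_rcosets\<^bsub>A\<^esub> I,
      monoid.mult = rcoset_mult A I,
      one = undefined,
      zero = I,
      add = set_add A,
      smult = (\<lambda>k C. \<Union>c\<in>C. I +>\<^bsub>A\<^esub> (k \<odot>\<^bsub>A\<^esub> c))\<rparr>"


section \<open>Free algebras\<close>

text \<open>Words under concatenation, written additively so that the product of
  \<^theory>\<open>HOL-Library.Poly_Mapping\<close> is the product of noncommutative polynomials.\<close>

datatype 'x free_monoid = Word (letters: "'x list")

instantiation free_monoid :: (type) monoid_add
begin

definition zero_free_monoid :: "'a free_monoid" where
  "0 = Word []"

definition plus_free_monoid :: "'a free_monoid \<Rightarrow> 'a free_monoid \<Rightarrow> 'a free_monoid" where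
  "u + v = Word (letters u @ letters v)"

instance
  by standard (simp_all add: zero_free_monoid_def plus_free_monoid_def)

end

text \<open>The free nonunital algebra on \<open>X\<close>: no constant terms.\<close>

definition free_algebra :: "'x set \<Rightarrow> ('k::field, 'x free_monoid \<Rightarrow>\<^sub>0 'k) module" where
  "free_algebra X =
     \<lparr>carrier = {p. \<forall>w\<in>Poly_Mapping.keys p. letters w \<noteq> [] \<and> set (letters w) \<subseteq> X},
      monoid.mult = (*),
      one = undefined,
      zero = 0,
      add = (+),
      smult = (\<lambda>k. Poly_Mapping.map ((*) k))\<rparr>"

definition monomial_of :: "'x list \<Rightarrow> ('x free_monoid \<Rightarrow>\<^sub>0 'k::field)" where
  "monomial_of xs = Poly_Mapping.single (Word xs) 1"


section \<open>Leavitt path algebras\<close>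

datatype ('v, 'e) generator = Vertex 'v | Edge 'e | Ghost 'e

definition generators :: "('v, 'e) pre_digraph \<Rightarrow> ('v, 'e) generator set" where
  "generators E = Vertex ` verts E \<union> Edge ` arcs E \<union> Ghost ` arcs E"

text \<open>An equation \<open>a = b\<close> is encoded as the element \<open>a - b\<close>.\<close>

definition leavitt_relations ::
    "('v, 'e) pre_digraph \<Rightarrow> (('v, 'e) generator free_monoid \<Rightarrow>\<^sub>0 'k::field) set" where
  "leavitt_relations E =
     \<comment> \<open>(V)\<close>
     {monomial_of [Vertex v, Vertex w] - (if v = w then monomial_of [Vertex v] else 0)
       | v w. v \<in> verts E \<and> w \<in> verts E} \<union>
     \<comment> \<open>(E1)\<close>
     {monomial_of [Vertex (tail E e), Edge e] - monomial_of [Edge e] | e. e \<in> arcs E} \<union>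
     {monomial_of [Edge e, Vertex (head E e)] - monomial_of [Edge e] | e. e \<in> arcs E} \<union>
     \<comment> \<open>(E2)\<close>
     {monomial_of [Vertex (head E e), Ghost e] - monomial_of [Ghost e] | e. e \<in> arcs E} \<union>
     {monomial_of [Ghost e, Vertex (tail E e)] - monomial_of [Ghost e] | e. e \<in> arcs E} \<union>
     \<comment> \<open>(CK1)\<close>
     {monomial_of [Ghost e, Edge f] - (if e = f then monomial_of [Vertex (head E e)] else 0)
       | e f. e \<in> arcs E \<and> f \<in> arcs E} \<union>
     \<comment> \<open>(CK2)\<close>
     {monomial_of [Vertex v] - (\<Sum>e\<in>out_arcs E v. monomial_of [Edge e, Ghost e])
       | v. v \<in> verts E \<and> out_arcs E v \<noteq> {} \<and> finite (out_arcs E v)}"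

definition leavitt_path_algebra ::
    "'k::field itself \<Rightarrow> ('v, 'e) pre_digraph \<Rightarrow>
      ('k, (('v, 'e) generator free_monoid \<Rightarrow>\<^sub>0 'k) set) module" where
  "leavitt_path_algebra _ E =
     quotient_algebra (free_algebra (generators E))
       (generated_ideal (free_algebra (generators E)) (leavitt_relations E))"


section \<open>Ring-theoretic notions\<close>

definition prime_ring :: "('a, 'c) ring_scheme \<Rightarrow> bool" where
  "prime_ring R \<longleftrightarrow>
     (\<forall>I J. ideal I R \<and> ideal J R \<and> I \<noteq> {\<zero>\<^bsub>R\<^esub>} \<and> J \<noteq> {\<zero>\<^bsub>R\<^esub>} \<longrightarrow> I \<cdot>\<^bsub>R\<^esub> J \<noteq> {\<zero>\<^bsub>R\<^esub>})"

definition von_neumann_regular :: "('a, 'c) ring_scheme \<Rightarrow> bool" where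
  "von_neumann_regular R \<longleftrightarrow>
     (\<forall>a\<in>carrier R. \<exists>x\<in>carrier R. a = a \<otimes>\<^bsub>R\<^esub> x \<otimes>\<^bsub>R\<^esub> a)"

text \<open>The locale \<^locale>\<open>module\<close> requires a commutative ring of scalars; \<^locale>\<open>submodule\<close> does not.\<close>

locale left_module = M?: abelian_group M
  for R :: "('a, 'c) ring_scheme" and M :: "('a, 'm) module" (structure) +
  assumes smult_closed: "\<lbrakk>r \<in> carrier R; x \<in> carrier M\<rbrakk> \<Longrightarrow> r \<odot> x \<in> carrier M"
    and smult_l_distr:
      "\<lbrakk>r \<in> carrier R; s \<in> carrier R; x \<in> carrier M\<rbrakk> \<Longrightarrow> (r \<oplus>\<^bsub>R\<^esub> s) \<odot> x = r \<odot> x \<oplus> s \<odot> x"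
    and smult_r_distr:
      "\<lbrakk>r \<in> carrier R; x \<in> carrier M; y \<in> carrier M\<rbrakk> \<Longrightarrow> r \<odot> (x \<oplus> y) = r \<odot> x \<oplus> r \<odot> y"
    and smult_assoc:
      "\<lbrakk>r \<in> carrier R; s \<in> carrier R; x \<in> carrier M\<rbrakk> \<Longrightarrow> (r \<otimes>\<^bsub>R\<^esub> s) \<odot> x = r \<odot> (s \<odot> x)"

text \<open>
  Simplicity over a possibly nonunital ring: \<open>RM \<noteq> 0\<close> and no submodules besides \<open>0\<close> and \<open>M\<close>.
  If \<open>R\<close> has an identity, it then acts as the identity on \<open>M\<close>: the submodule \<open>1M\<close> contains
  \<open>RM \<noteq> 0\<close>, so \<open>1M = M\<close>.
\<close>

definition simple_left_module :: "('a, 'c) ring_scheme \<Rightarrow> ('a, 'm) module \<Rightarrow> bool" where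
  "simple_left_module R M \<longleftrightarrow>
     left_module R M \<and>
     (\<exists>r\<in>carrier R. \<exists>x\<in>carrier M. r \<odot>\<^bsub>M\<^esub> x \<noteq> \<zero>\<^bsub>M\<^esub>) \<and>
     (\<forall>N. submodule N R M \<longrightarrow> N = {\<zero>\<^bsub>M\<^esub>} \<or> N = carrier M)"

definition faithful_left_module :: "('a, 'c) ring_scheme \<Rightarrow> ('a, 'm) module \<Rightarrow> bool" where
  "faithful_left_module R M \<longleftrightarrow>
     left_module R M \<and>
     (\<forall>r\<in>carrier R. (\<forall>x\<in>carrier M. r \<odot>\<^bsub>M\<^esub> x = \<zero>\<^bsub>M\<^esub>) \<longrightarrow> r = \<zero>\<^bsub>R\<^esub>)"

text \<open>
  HOL cannot quantify over types inside a formula, so the type of the elements of the module is a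
  parameter. A theorem \<open>\<not> primitive_ring TYPE('m) R\<close> with \<open>'m\<close> a type variable excludes simple
  faithful left modules of every type.
\<close>

definition primitive_ring :: "'m itself \<Rightarrow> ('a, 'c) ring_scheme \<Rightarrow> bool" where
  "primitive_ring _ R \<longleftrightarrow>
     (\<exists>M :: ('a, 'm) module. simple_left_module R M \<and> faithful_left_module R M)"

end

theory Submission
  imports Defs
begin

text \<open>
  Every vertex of the graph emits infinitely many edges, so (CK2) imposes nothing, and the algebra is
  spanned by the monomials \<open>p q\<^sup>*\<close> for paths \<open>p\<close>, \<open>q\<close> with a common end. The end of a nonzero
  product of monomials is the larger one of their ends, and the monomials with a fixed end multiply like matrix
  units. So the monomials that end in a finite set of vertices span a subalgebra that is filtered by
  ideals whose successive quotients are algebras of finitely supported matrices.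

  Regularity: by McCoy's lemma an element \<open>x\<close> is regular if \<open>x - x y x\<close> is, for some \<open>y\<close>. A scalar
  multiple of a monomial as \<open>y\<close> clears one column of the part of \<open>x\<close> with the lowest end
  (\<open>combination_pivot\<close>), and the inverse of the constant term as \<open>y\<close> removes the constant term.

  Primeness: every nonzero ideal contains a vertex (\<open>compress_to_vertex\<close>) and then all larger
  vertices. Vertices are nonzero since they act as nonzero operators on the space of paths.

  Nonprimitivity: let \<open>M\<close> be a faithful simple module and \<open>m \<noteq> 0\<close> in \<open>M\<close>. For each vertex \<open>u\<close> the
  monomials that end beyond \<open>u\<close> span a nonzero ideal, so some \<open>y\<close> in it satisfies \<open>y m = m\<close>
  (\<open>fixing_element\<close>). Thus there are paths \<open>q\<close> with \<open>q\<^sup>* m \<noteq> 0\<close> that end beyond any given vertex. On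
  the other hand, the same property, applied to \<open>q\<^sup>* m\<close> in place of \<open>m\<close>, shows that such a path can be
  prolonged by only finitely many edges. So there are only countably many of these paths, and their
  ends form a countable cofinal set, which does not exist.

  Nonisomorphism: an isomorphism maps a generator to an element that meets only finitely many vertices
  of the other graph, and all vertices are met by the image of some generator. So isomorphic algebras
  belong to ordinals of the same cardinality (\<open>iso_imp_lepoll\<close>).
\<close>

section \<open>Noncommutative polynomials with constant term\<close>

abbreviation const :: "'k::field \<Rightarrow> ('x free_monoid \<Rightarrow>\<^sub>0 'k)" where
  "const \<equiv> Poly_Mapping.single 0"

abbreviation letter :: "'x \<Rightarrow> ('x free_monoid \<Rightarrow>\<^sub>0 'k::field)" where
  "letter x \<equiv> monomial_of [x]"

text \<open>The free \<^emph>\<open>unital\<close> algebra on \<open>X\<close>, as a subset of the ring of all polynomials.\<close>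

definition unital_polys :: "'x set \<Rightarrow> ('x free_monoid \<Rightarrow>\<^sub>0 'k::field) set" where
  "unital_polys X = {p. \<forall>w\<in>Poly_Mapping.keys p. set (letters w) \<subseteq> X}"

lemma letters_zero [simp]: "letters 0 = []"
  by (simp add: zero_free_monoid_def)

lemma letters_plus [simp]: "letters (u + v) = letters u @ letters v"
  by (simp add: plus_free_monoid_def)

lemma letters_eq_Nil_iff: "letters w = [] \<longleftrightarrow> w = 0"
  by (cases w) (simp add: zero_free_monoid_def)

lemma plus_free_monoid_eq_zero_iff: "u + v = 0 \<longleftrightarrow> u = 0 \<and> v = (0 :: 'x free_monoid)"
  by (metis append_is_Nil_conv letters_eq_Nil_iff letters_plus)

lemma monomial_of_Cons: "monomial_of (x # xs) = letter x * monomial_of xs"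
  by (simp add: monomial_of_def mult_single plus_free_monoid_def)

lemma monomial_of_Nil: "monomial_of [] = 1"
  by (simp add: monomial_of_def zero_free_monoid_def[symmetric])

lemma monomial_of_pair: "monomial_of [x, y] = letter x * letter y"
  by (rule monomial_of_Cons)

lemma poly_sum_monomials:
  "x = (\<Sum>w\<in>Poly_Mapping.keys x. const (Poly_Mapping.lookup x w) * Poly_Mapping.single w 1)"
  by (rule poly_mapping_eqI)
     (auto simp: mult_single lookup_sum lookup_single when_def in_keys_iff)

lemma const_mult: "const a * const b = const (a * b)"
  by (simp add: mult_single)

lemma const_inverse_mult: "k \<noteq> 0 \<Longrightarrow> const (inverse k) * (const k * x) = x"
  by (simp add: mult.assoc[symmetric] mult_single)

lemma const_add: "const a + const b = const (a + b)"
  by (simp add: single_add)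

lemma const_commute: "x * const k = const k * x"
proof -
  have "(\<Sum>w\<in>Poly_Mapping.keys x. const (Poly_Mapping.lookup x w) * Poly_Mapping.single w 1) * const k
      = const k * (\<Sum>w\<in>Poly_Mapping.keys x. const (Poly_Mapping.lookup x w) * Poly_Mapping.single w 1)"
    by (simp add: sum_distrib_left sum_distrib_right mult_single mult.commute)
  then show ?thesis
    using poly_sum_monomials[of x] by simp
qed

lemma const_left_commute: "x * (const k * y) = const k * (x * y)"
  by (metis const_commute mult.assoc)

context
  fixes X :: "'x set"
begin

lemma unital_polys_const [simp, intro]: "const k \<in> unital_polys X"
  by (simp add: unital_polys_def)

lemma unital_polys_zero [simp, intro]: "0 \<in> unital_polys X"
  by (simp add: unital_polys_def)

lemma unital_polys_one [simp, intro]: "1 \<in> unital_polys X"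
  by (simp add: unital_polys_def)

lemma unital_polys_monomial_of [simp, intro]: "set xs \<subseteq> X \<Longrightarrow> monomial_of xs \<in> unital_polys X"
  by (simp add: unital_polys_def monomial_of_def)

lemma unital_polys_add [simp, intro]:
  "x \<in> unital_polys X \<Longrightarrow> y \<in> unital_polys X \<Longrightarrow> x + y \<in> unital_polys X"
  using keys_add[of x y] by (auto simp: unital_polys_def)

lemma unital_polys_mult [simp, intro]:
  "x \<in> unital_polys X \<Longrightarrow> y \<in> unital_polys X \<Longrightarrow> x * y \<in> unital_polys X"
  using keys_mult[of x y] by (fastforce simp: unital_polys_def)

lemma unital_polys_uminus [simp, intro]: "x \<in> unital_polys X \<Longrightarrow> - x \<in> unital_polys X"
  by (simp add: unital_polys_def in_keys_iff)

lemma unital_polys_diff [simp, intro]: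
  "x \<in> unital_polys X \<Longrightarrow> y \<in> unital_polys X \<Longrightarrow> x - y \<in> unital_polys X"
  using unital_polys_add[of x "- y"] unital_polys_uminus[of y] by simp

lemma unital_polys_sum [simp, intro]:
  "(\<And>i. i \<in> A \<Longrightarrow> f i \<in> unital_polys X) \<Longrightarrow> sum f A \<in> unital_polys X"
  by (induction A rule: infinite_finite_induct) auto

lemma unital_polys_induct [consumes 1, case_names one add const letter]:
  fixes x :: "'x free_monoid \<Rightarrow>\<^sub>0 'k::field"
  assumes x: "x \<in> unital_polys X"
    and one: "P 1"
    and add: "\<And>x y. \<lbrakk>x \<in> unital_polys X; y \<in> unital_polys X; P x; P y\<rbrakk> \<Longrightarrow> P (x + y)"
    and smult: "\<And>k x. \<lbrakk>x \<in> unital_polys X; P x\<rbrakk> \<Longrightarrow> P (const k * x)"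
    and gen: "\<And>a x. \<lbrakk>a \<in> X; x \<in> unital_polys X; P x\<rbrakk> \<Longrightarrow> P (letter a * x)"
  shows "P x"
proof -
  have mono: "(monomial_of xs :: 'x free_monoid \<Rightarrow>\<^sub>0 'k) \<in> unital_polys X \<and> P (monomial_of xs)" if "set xs \<subseteq> X" for xs
    using that
  proof (induction xs)
    case Nil
    then show ?case using one by (simp add: monomial_of_Nil)
  next
    case (Cons a xs)
    then show ?case
      unfolding monomial_of_Cons[of a xs] using gen[of a "monomial_of xs"] by auto
  qed
  have zero: "P 0"
    using smult[OF unital_polys_one one, of 0] by simp
  have "Poly_Mapping.single w (1 :: 'k) \<in> unital_polys X \<and> P (Poly_Mapping.single w 1)"
    if "w \<in> Poly_Mapping.keys x" for w
    using mono[of "letters w"] that x by (simp add: monomial_of_def unital_polys_def)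
  then have "(\<Sum>w\<in>A. const (Poly_Mapping.lookup x w) * Poly_Mapping.single w 1) \<in> unital_polys X
      \<and> P (\<Sum>w\<in>A. const (Poly_Mapping.lookup x w) * Poly_Mapping.single w 1)"
    if "A \<subseteq> Poly_Mapping.keys x" for A
    using that
    by (induction A rule: infinite_finite_induct) (auto simp: zero intro!: add smult)
  from this[OF order_refl] show ?thesis
    using poly_sum_monomials[of x] by simp
qed

end

text \<open>Linear extension of a function on words; it serves to define linear functionals.\<close>

definition linear_ext :: "('x free_monoid \<Rightarrow> 'k::field) \<Rightarrow> ('x free_monoid \<Rightarrow>\<^sub>0 'k) \<Rightarrow> 'k" where
  "linear_ext f x = (\<Sum>w\<in>Poly_Mapping.keys x. Poly_Mapping.lookup x w * f w)"

lemma linear_ext_superset: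
  assumes "finite A" "Poly_Mapping.keys x \<subseteq> A"
  shows "linear_ext f x = (\<Sum>w\<in>A. Poly_Mapping.lookup x w * f w)"
  unfolding linear_ext_def by (rule sum.mono_neutral_left) (use assms in \<open>auto simp: in_keys_iff\<close>)

lemma linear_ext_zero [simp]: "linear_ext f 0 = 0"
  by (simp add: linear_ext_def)

lemma linear_ext_single [simp]: "linear_ext f (Poly_Mapping.single w k) = k * f w"
  by (simp add: linear_ext_def)

lemma linear_ext_add: "linear_ext f (x + y) = linear_ext f x + linear_ext f y"
proof -
  let ?A = "Poly_Mapping.keys x \<union> Poly_Mapping.keys y"
  have "linear_ext f (x + y) = (\<Sum>w\<in>?A. Poly_Mapping.lookup (x + y) w * f w)"
    by (rule linear_ext_superset) (use keys_add[of x y] in auto)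
  also have "\<dots> = linear_ext f x + linear_ext f y"
    by (simp add: linear_ext_superset[of ?A] lookup_add distrib_right sum.distrib)
  finally show ?thesis .
qed

lemma linear_ext_uminus: "linear_ext f (- x) = - linear_ext f x"
  using linear_ext_add[of f x "- x"] by (simp add: eq_neg_iff_add_eq_0 add.commute)

lemma linear_ext_diff: "linear_ext f (x - y) = linear_ext f x - linear_ext f y"
  using linear_ext_add[of f x "- y"] by (simp add: linear_ext_uminus)

lemma linear_ext_sum: "linear_ext f (\<Sum>i\<in>A. g i) = (\<Sum>i\<in>A. linear_ext f (g i))"
  by (induction A rule: infinite_finite_induct) (auto simp: linear_ext_add)

lemma linear_ext_monomial_of [simp]: "linear_ext f (monomial_of xs) = f (Word xs)"
  by (simp add: monomial_of_def)

lemma linear_ext_mult: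
  fixes x y :: "'x free_monoid \<Rightarrow>\<^sub>0 'k::field"
  shows "linear_ext f (x * y) = linear_ext (\<lambda>u. linear_ext (\<lambda>v. f (u + v)) y) x"
proof -
  define m where "m z w = Poly_Mapping.single w (Poly_Mapping.lookup z w)"
    for z :: "'x free_monoid \<Rightarrow>\<^sub>0 'k" and w
  have decomp: "z = (\<Sum>w\<in>Poly_Mapping.keys z. m z w)" for z
    using poly_sum_monomials[of z] by (simp add: m_def mult_single)
  have "x * y = (\<Sum>u\<in>Poly_Mapping.keys x. \<Sum>v\<in>Poly_Mapping.keys y. m x u * m y v)"
    by (subst decomp[of x], subst decomp[of y]) (rule sum_product)
  then have "linear_ext f (x * y) =
      (\<Sum>u\<in>Poly_Mapping.keys x. \<Sum>v\<in>Poly_Mapping.keys y. linear_ext f (m x u * m y v))"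
    by (simp add: linear_ext_sum)
  also have "\<dots> = linear_ext (\<lambda>u. linear_ext (\<lambda>v. f (u + v)) y) x"
    by (simp add: linear_ext_def[of _ x] linear_ext_def[of _ y] m_def mult_single
        sum_distrib_left mult.assoc)
  finally show ?thesis .
qed

lemma linear_ext_const_mult: "linear_ext f (const k * x) = k * linear_ext f x"
  by (simp add: linear_ext_mult)

lemma linear_ext_swap:
  "linear_ext (\<lambda>u. linear_ext (f u) y) x = linear_ext (\<lambda>v. linear_ext (\<lambda>u. f u v) x) y"
proof -
  have "linear_ext (\<lambda>u. linear_ext (f u) y) x = (\<Sum>u\<in>Poly_Mapping.keys x.
      \<Sum>v\<in>Poly_Mapping.keys y. Poly_Mapping.lookup x u * (Poly_Mapping.lookup y v * f u v))"
    by (simp add: linear_ext_def sum_distrib_left)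
  also have "\<dots> = (\<Sum>v\<in>Poly_Mapping.keys y. \<Sum>u\<in>Poly_Mapping.keys x.
      Poly_Mapping.lookup y v * (Poly_Mapping.lookup x u * f u v))"
    by (subst sum.swap) (simp add: mult.left_commute)
  also have "\<dots> = linear_ext (\<lambda>v. linear_ext (\<lambda>u. f u v) x) y"
    by (simp add: linear_ext_def sum_distrib_left)
  finally show ?thesis .
qed

abbreviation const_term :: "('x free_monoid \<Rightarrow>\<^sub>0 'k::field) \<Rightarrow> 'k" where
  "const_term x \<equiv> Poly_Mapping.lookup x 0"

lemma linear_ext_at_zero: "linear_ext (\<lambda>w. if w = 0 then c else 0) x = const_term x * c"
  by (auto simp: linear_ext_def if_distrib in_keys_iff cong: if_cong)

lemma const_term_mult: "const_term (x * y) = const_term x * const_term y"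
proof -
  have "const_term (x * y) =
      linear_ext (\<lambda>u. linear_ext (\<lambda>v. if u + v = 0 then 1 else 0) y) x"
    using linear_ext_at_zero[of 1 "x * y"] by (simp add: linear_ext_mult)
  also have "(\<lambda>u. linear_ext (\<lambda>v. if u + v = 0 then 1 else 0) y)
      = (\<lambda>u. if u = 0 then const_term y else 0)"
    using linear_ext_at_zero[of 1 y]
    by (auto simp: fun_eq_iff plus_free_monoid_eq_zero_iff linear_ext_def)
  finally show ?thesis by (simp add: linear_ext_at_zero)
qed

lemma const_term_simps [simp]:
  "const_term (const k) = k" "const_term (letter a) = 0"
  by (simp_all add: monomial_of_def lookup_single zero_free_monoid_def)

lemma carrier_free_algebra_iff:
  "x \<in> carrier (free_algebra X) \<longleftrightarrow> x \<in> unital_polys X \<and> const_term x = 0"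
  unfolding free_algebra_def unital_polys_def
  by (auto simp: in_keys_iff letters_eq_Nil_iff)

section \<open>Unitization of an algebra given by generators and relations\<close>

text \<open>
  Computations take place in the ring of polynomials, modulo the ideal of relations. The free
  unital algebra on \<open>X\<close> maps onto the unitization of the presented algebra with exactly this ideal
  as its kernel, because relations have no constant term.
\<close>

locale presentation =
  fixes X :: "'x set" and S :: "('x free_monoid \<Rightarrow>\<^sub>0 'k::field) set"
  assumes relations_closed: "S \<subseteq> carrier (free_algebra X)"
begin

text \<open>The ideal of relations, generated in the nonunital free algebra.\<close>

definition rel_ideal :: "('x free_monoid \<Rightarrow>\<^sub>0 'k) set" where
  "rel_ideal = generated_ideal (free_algebra X) S"

text \<open>
  Equality of the elements of the unitization that two polynomials represent. Membership in the
  free unital algebra is part of the relation, so that it is compatible with products.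
\<close>

definition eqv :: "('x free_monoid \<Rightarrow>\<^sub>0 'k) \<Rightarrow> ('x free_monoid \<Rightarrow>\<^sub>0 'k) \<Rightarrow> bool"
    (infix \<open>\<approx>\<^sub>r\<close> 50) where
  "x \<approx>\<^sub>r y \<longleftrightarrow> x \<in> unital_polys X \<and> y \<in> unital_polys X \<and> x - y \<in> rel_ideal"

abbreviation "U \<equiv> unitization (quotient_algebra (free_algebra X) rel_ideal)"

text \<open>The canonical surjection from the free unital algebra.\<close>

definition proj :: "('x free_monoid \<Rightarrow>\<^sub>0 'k) \<Rightarrow> 'k \<times> ('x free_monoid \<Rightarrow>\<^sub>0 'k) set" where
  "proj x = (const_term x, (\<lambda>i. i + (x - const (const_term x))) ` rel_ideal)"

lemma rel_ideal_subset: "x \<in> rel_ideal \<Longrightarrow> x \<in> carrier (free_algebra X)"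
  unfolding rel_ideal_def
proof (induction rule: generated_ideal.induct)
  case (generator x)
  then show ?case using relations_closed by auto
qed (auto simp: free_algebra_def[of X, THEN arg_cong[where f=zero]]
    free_algebra_def[of X, THEN arg_cong[where f=add]]
    free_algebra_def[of X, THEN arg_cong[where f="monoid.mult"]]
    free_algebra_def[of X, THEN arg_cong[where f=smult]]
    mult_map_scale_conv_mult carrier_free_algebra_iff lookup_add const_term_mult)

lemma rel_ideal_induct [consumes 1, case_names generator zero add const mult_l mult_r]:
  assumes "x \<in> rel_ideal"
    and "\<And>x. x \<in> S \<Longrightarrow> P x" and "P 0"
    and "\<And>x y. P x \<Longrightarrow> P y \<Longrightarrow> P (x + y)"
    and "\<And>k x. P x \<Longrightarrow> P (const k * x)"
    and "\<And>a x. P x \<Longrightarrow> P (a * x)"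
    and "\<And>a x. P x \<Longrightarrow> P (x * a)"
  shows "P x"
  using assms(1) unfolding rel_ideal_def
  by (induction rule: generated_ideal.induct)
     (use assms(2-) in \<open>simp_all add: free_algebra_def mult_map_scale_conv_mult\<close>)

lemma rel_ideal_polys: "x \<in> rel_ideal \<Longrightarrow> x \<in> unital_polys X"
  and rel_ideal_const_term: "x \<in> rel_ideal \<Longrightarrow> const_term x = 0"
  using rel_ideal_subset by (auto simp: carrier_free_algebra_iff)

lemma rel_ideal_generator: "x \<in> S \<Longrightarrow> x \<in> rel_ideal"
  unfolding rel_ideal_def by (rule generated_ideal.generator)

lemma rel_ideal_zero [simp]: "0 \<in> rel_ideal"
  using generated_ideal.zero[of "free_algebra X" S] by (simp add: rel_ideal_def free_algebra_def)

lemma rel_ideal_add: "x \<in> rel_ideal \<Longrightarrow> y \<in> rel_ideal \<Longrightarrow> x + y \<in> rel_ideal"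
  using generated_ideal.add[of x "free_algebra X" S y]
  by (simp add: rel_ideal_def free_algebra_def)

lemma rel_ideal_const: "x \<in> rel_ideal \<Longrightarrow> const k * x \<in> rel_ideal"
  using generated_ideal.smult[of x "free_algebra X" S k]
  by (simp add: rel_ideal_def free_algebra_def mult_map_scale_conv_mult)

lemma rel_ideal_uminus: "x \<in> rel_ideal \<Longrightarrow> - x \<in> rel_ideal"
  using rel_ideal_const[of x "- 1"] by (simp add: single_uminus)

lemma rel_ideal_diff: "x \<in> rel_ideal \<Longrightarrow> y \<in> rel_ideal \<Longrightarrow> x - y \<in> rel_ideal"
  using rel_ideal_add[of x "- y"] rel_ideal_uminus[of y] by simp

lemma split_const:
  assumes "x \<in> unital_polys X"
  obtains y where "y \<in> carrier (free_algebra X)" "x = const (const_term x) + y"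
proof
  show "x - const (const_term x) \<in> carrier (free_algebra X)"
    using assms by (auto simp: carrier_free_algebra_iff lookup_minus)
qed simp

lemma rel_ideal_mult_l:
  assumes "a \<in> unital_polys X" "x \<in> rel_ideal"
  shows "a * x \<in> rel_ideal"
proof -
  obtain b where b: "b \<in> carrier (free_algebra X)" "a = const (const_term a) + b"
    using split_const[OF assms(1)] .
  have "b * x \<in> rel_ideal"
    using generated_ideal.mult_l[of b "free_algebra X" x S] b(1) assms(2)
    by (simp add: rel_ideal_def free_algebra_def)
  then show ?thesis
    by (subst b(2)) (simp add: distrib_right rel_ideal_add rel_ideal_const assms(2))
qed

lemma rel_ideal_mult_r:
  assumes "a \<in> unital_polys X" "x \<in> rel_ideal"
  shows "x * a \<in> rel_ideal"
proof -
  obtain b where b: "b \<in> carrier (free_algebra X)" "a = const (const_term a) + b"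
    using split_const[OF assms(1)] .
  have "x * b \<in> rel_ideal"
    using generated_ideal.mult_r[of b "free_algebra X" x S] b(1) assms(2)
    by (simp add: rel_ideal_def free_algebra_def)
  then show ?thesis
    by (subst b(2)) (simp add: distrib_left rel_ideal_add rel_ideal_const assms(2) const_commute)
qed

subsection \<open>The congruence\<close>

lemma eqv_refl [simp]: "x \<approx>\<^sub>r x \<longleftrightarrow> x \<in> unital_polys X"
  by (simp add: eqv_def)

lemma eqv_polys: "x \<approx>\<^sub>r y \<Longrightarrow> x \<in> unital_polys X" "x \<approx>\<^sub>r y \<Longrightarrow> y \<in> unital_polys X"
  by (simp_all add: eqv_def)

lemma eqv_sym: "x \<approx>\<^sub>r y \<Longrightarrow> y \<approx>\<^sub>r x"
  using rel_ideal_uminus[of "x - y"] by (auto simp: eqv_def)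

lemma eqv_trans [trans]: "x \<approx>\<^sub>r y \<Longrightarrow> y \<approx>\<^sub>r z \<Longrightarrow> x \<approx>\<^sub>r z"
  using rel_ideal_add[of "x - y" "y - z"] by (auto simp: eqv_def)

lemma eqv_add: "x \<approx>\<^sub>r y \<Longrightarrow> z \<approx>\<^sub>r w \<Longrightarrow> x + z \<approx>\<^sub>r y + w"
  using rel_ideal_add[of "x - y" "z - w"] by (auto simp: eqv_def algebra_simps)

lemma eqv_diff: "x \<approx>\<^sub>r y \<Longrightarrow> z \<approx>\<^sub>r w \<Longrightarrow> x - z \<approx>\<^sub>r y - w"
  using rel_ideal_diff[of "x - y" "z - w"] by (auto simp: eqv_def algebra_simps)

lemma eqv_mult: "x \<approx>\<^sub>r y \<Longrightarrow> z \<approx>\<^sub>r w \<Longrightarrow> x * z \<approx>\<^sub>r y * w"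
  using rel_ideal_add[OF rel_ideal_mult_r[of z "x - y"] rel_ideal_mult_l[of y "z - w"]]
  by (auto simp: eqv_def algebra_simps)

lemma eqv_const: "x \<approx>\<^sub>r y \<Longrightarrow> const k * x \<approx>\<^sub>r const k * y"
  by (rule eqv_mult) auto

lemma eqv_mult_l: "x \<approx>\<^sub>r y \<Longrightarrow> a \<in> unital_polys X \<Longrightarrow> a * x \<approx>\<^sub>r a * y"
  by (rule eqv_mult) auto

lemma eqv_mult_r: "x \<approx>\<^sub>r y \<Longrightarrow> a \<in> unital_polys X \<Longrightarrow> x * a \<approx>\<^sub>r y * a"
  by (rule eqv_mult) auto

lemma eqv_sum: "(\<And>i. i \<in> A \<Longrightarrow> f i \<approx>\<^sub>r g i) \<Longrightarrow> sum f A \<approx>\<^sub>r sum g A"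
  by (induction A rule: infinite_finite_induct) (auto intro: eqv_add)

lemma eqv_zero_iff: "x \<approx>\<^sub>r 0 \<longleftrightarrow> x \<in> rel_ideal"
  using rel_ideal_polys by (auto simp: eqv_def)

lemma eqv_const_term: "x \<approx>\<^sub>r y \<Longrightarrow> const_term x = const_term y"
  using rel_ideal_const_term[of "x - y"] by (simp add: eqv_def lookup_minus)

subsection \<open>The canonical surjection\<close>

abbreviation coset :: "('x free_monoid \<Rightarrow>\<^sub>0 'k) \<Rightarrow> ('x free_monoid \<Rightarrow>\<^sub>0 'k) set" where
  "coset x \<equiv> (\<lambda>i. i + x) ` rel_ideal"

lemma mem_coset: "y \<in> coset x \<longleftrightarrow> y - x \<in> rel_ideal"
  by (auto simp: image_iff intro: bexI[of _ "y - x"])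

lemma coset_eq_iff: "coset x = coset y \<longleftrightarrow> x - y \<in> rel_ideal"
proof
  assume "coset x = coset y"
  moreover have "x \<in> coset x" by (simp add: mem_coset)
  ultimately show "x - y \<in> rel_ideal" by (simp add: mem_coset)
next
  assume *: "x - y \<in> rel_ideal"
  have "z - x \<in> rel_ideal \<longleftrightarrow> z - y \<in> rel_ideal" for z
    using rel_ideal_add[OF _ *, of "z - x"] rel_ideal_diff[OF _ *, of "z - y"] by auto
  then show "coset x = coset y" by (intro Set.set_eqI) (simp only: mem_coset)
qed

lemma a_r_coset_eq: "rel_ideal +>\<^bsub>free_algebra X\<^esub> x = coset x"
  by (auto simp: a_r_coset_def r_coset_def free_algebra_def)

lemma carrier_quotient: "carrier (quotient_algebra (free_algebra X) rel_ideal)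
    = coset ` carrier (free_algebra X)"
  by (auto simp: quotient_algebra_def A_RCOSETS_def RCOSETS_def a_r_coset_def[symmetric]
      a_r_coset_eq)

lemma zero_quotient: "zero (quotient_algebra (free_algebra X) rel_ideal) = coset 0"
  by (simp add: quotient_algebra_def)

lemma add_quotient:
  "add (quotient_algebra (free_algebra X) rel_ideal) (coset x) (coset y) = coset (x + y)"
proof -
  have "add (quotient_algebra (free_algebra X) rel_ideal) (coset x) (coset y) =
      (\<Union>a\<in>coset x. \<Union>b\<in>coset y. {a + b})"
    by (simp add: quotient_algebra_def set_add_def set_mult_def free_algebra_def)
  also have "\<dots> = coset (x + y)"
  proof (intro Set.set_eqI iffI)
    fix z assume "z \<in> (\<Union>a\<in>coset x. \<Union>b\<in>coset y. {a + b})"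
    then obtain i j where "i \<in> rel_ideal" "j \<in> rel_ideal" "z = i + x + (j + y)" by auto
    then show "z \<in> coset (x + y)"
      using rel_ideal_add[of i j] by (auto simp: mem_coset algebra_simps)
  next
    fix z assume "z \<in> coset (x + y)"
    then obtain i where "i \<in> rel_ideal" "z = (i + x) + (0 + y)" by (auto simp: algebra_simps)
    then show "z \<in> (\<Union>a\<in>coset x. \<Union>b\<in>coset y. {a + b})"
      using rel_ideal_zero by blast
  qed
  finally show ?thesis .
qed

lemma mult_quotient:
  assumes "x \<in> unital_polys X" "y \<in> unital_polys X"
  shows "monoid.mult (quotient_algebra (free_algebra X) rel_ideal) (coset x) (coset y)
    = coset (x * y)"
proof -
  have "monoid.mult (quotient_algebra (free_algebra X) rel_ideal) (coset x) (coset y) =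
      (\<Union>a\<in>coset x. \<Union>b\<in>coset y. coset (a * b))"
    by (simp only: quotient_algebra_def rcoset_mult_def a_r_coset_eq monoid.select_convs)
       (simp add: free_algebra_def)
  also have "\<dots> = (\<Union>a\<in>coset x. \<Union>b\<in>coset y. coset (x * y))"
  proof (intro SUP_cong refl)
    fix a b assume ab: "a \<in> coset x" "b \<in> coset y"
    have "a \<approx>\<^sub>r x" "b \<approx>\<^sub>r y"
      using ab assms by (auto simp: eqv_def rel_ideal_polys)
    then have "a * b \<approx>\<^sub>r x * y" by (rule eqv_mult)
    then show "coset (a * b) = coset (x * y)" by (simp only: coset_eq_iff eqv_def)
  qed
  also have "\<dots> = coset (x * y)" using rel_ideal_zero by blast
  finally show ?thesis .
qed

lemma smult_quotient:
  "smult (quotient_algebra (free_algebra X) rel_ideal) k (coset x) = coset (const k * x)"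
proof -
  have "smult (quotient_algebra (free_algebra X) rel_ideal) k (coset x) =
      (\<Union>a\<in>coset x. coset (const k * a))"
    by (simp only: quotient_algebra_def a_r_coset_eq module.select_convs)
       (simp add: free_algebra_def mult_map_scale_conv_mult)
  also have "\<dots> = (\<Union>a\<in>coset x. coset (const k * x))"
  proof (intro SUP_cong refl)
    fix a assume "a \<in> coset x"
    then show "coset (const k * a) = coset (const k * x)"
      using rel_ideal_const[of "a - x" k]
      by (simp only: coset_eq_iff mem_coset right_diff_distrib)
  qed
  also have "\<dots> = coset (const k * x)" using rel_ideal_zero by blast
  finally show ?thesis .
qed

lemma proj_closed: "x \<in> unital_polys X \<Longrightarrow> proj x \<in> carrier U"
  by (auto simp: proj_def unitization_def carrier_quotient carrier_free_algebra_iff lookup_minus)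

lemma proj_surj:
  assumes "z \<in> carrier U"
  obtains x where "x \<in> unital_polys X" "z = proj x"
proof -
  obtain k x where z: "z = (k, coset x)" "x \<in> carrier (free_algebra X)"
    using assms by (auto simp: unitization_def carrier_quotient)
  show thesis
  proof
    show "const k + x \<in> unital_polys X" "z = proj (const k + x)"
      using z by (auto simp: proj_def carrier_free_algebra_iff lookup_add)
  qed
qed

lemma carrier_U: "carrier U = proj ` unital_polys X"
  using proj_closed by (auto elim: proj_surj)

lemma proj_eq_iff:
  assumes "x \<in> unital_polys X" "y \<in> unital_polys X"
  shows "proj x = proj y \<longleftrightarrow> x \<approx>\<^sub>r y"
proof -
  have "proj x = proj y \<longleftrightarrow> const_term x = const_term y \<and>
      (x - const (const_term x)) - (y - const (const_term y)) \<in> rel_ideal"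
    by (simp only: proj_def prod.inject coset_eq_iff)
  also have "\<dots> \<longleftrightarrow> x - y \<in> rel_ideal"
    using rel_ideal_const_term[of "x - y"] by (auto simp: lookup_minus)
  finally show ?thesis using assms by (simp add: eqv_def)
qed

lemma proj_zero: "zero U = proj 0"
  by (simp add: unitization_def proj_def zero_quotient)

lemma proj_one: "one U = proj 1"
  by (simp add: unitization_def proj_def zero_quotient lookup_one)

lemma proj_add:
  "add U (proj x) (proj y) = proj (x + y)"
  by (simp only: unitization_def proj_def ring.select_convs prod.case add_quotient)
     (simp add: lookup_add const_add[symmetric] algebra_simps)

lemma proj_smult:
  "smult U k (proj x) = proj (const k * x)"
  by (simp only: unitization_def proj_def module.select_convs prod.case smult_quotient)
     (simp add: const_term_mult const_mult algebra_simps)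

lemma proj_mult:
  assumes "x \<in> unital_polys X" "y \<in> unital_polys X"
  shows "monoid.mult U (proj x) (proj y) = proj (x * y)"
proof -
  have "x - const (const_term x) \<in> unital_polys X" "y - const (const_term y) \<in> unital_polys X"
    using assms by auto
  then show ?thesis
    by (simp only: unitization_def proj_def monoid.select_convs prod.case smult_quotient
        add_quotient mult_quotient)
       (simp add: const_term_mult const_mult[symmetric] const_commute[of x "const_term y"]
         const_commute[of "const (const_term x)" "const_term y"] algebra_simps)
qed

lemmas proj_hom = proj_zero proj_one proj_add proj_smult proj_mult

lemma unital_algebra_U: "unital_algebra U"
proof -
  have neg: "\<exists>z\<in>carrier U. z \<oplus>\<^bsub>U\<^esub> proj x = \<zero>\<^bsub>U\<^esub>" if "x \<in> unital_polys X" for x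
    using that by (intro bexI[of _ "proj (- x)"]) (auto simp: proj_hom proj_closed)
  have "abelian_group U"
    by (rule abelian_groupI)
       (auto elim!: proj_surj simp: proj_hom proj_closed ac_simps neg[unfolded proj_zero])
  moreover have "monoid U"
    by (rule monoidI) (auto elim!: proj_surj simp: proj_hom proj_closed mult.assoc)
  ultimately interpret ring U
    by (rule ringI) (auto elim!: proj_surj simp: proj_hom distrib_left distrib_right)
  show ?thesis
  proof unfold_locales
    fix x y and k :: 'k
    assume "x \<in> carrier U" "y \<in> carrier U"
    then show "x \<otimes>\<^bsub>U\<^esub> (k \<odot>\<^bsub>U\<^esub> y) = k \<odot>\<^bsub>U\<^esub> (x \<otimes>\<^bsub>U\<^esub> y)"
      by (auto simp: carrier_U proj_hom const_left_commute[of _ k])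
  qed (auto simp: carrier_U proj_hom distrib_left distrib_right const_add[symmetric]
      const_mult[symmetric] mult.assoc)
qed

end

section \<open>Leavitt path algebras of ordinals\<close>

text \<open>An ordinal of uncountable cofinality and a field of coefficients.\<close>

locale leavitt_ordinal =
  fixes \<kappa> :: "'a rel" and K :: "'k::field itself"
  assumes well_order: "Well_order \<kappa>"
    and uncountable_cofinality: "uncountable_cofinality \<kappa>"
begin

subsection \<open>The order\<close>

text \<open>The strict order of the ordinal.\<close>

definition less :: "'a \<Rightarrow> 'a \<Rightarrow> bool" (infix \<open>\<lless>\<close> 50) where
  "a \<lless> b \<longleftrightarrow> (a, b) \<in> \<kappa> \<and> a \<noteq> b"

lemma less_irrefl [simp]: "\<not> a \<lless> a"
  by (simp add: less_def)

lemma less_Field: "a \<lless> b \<Longrightarrow> a \<in> Field \<kappa>" "a \<lless> b \<Longrightarrow> b \<in> Field \<kappa>"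
  by (auto simp: less_def Field_def)

lemma trans_\<kappa>: "trans \<kappa>" and antisym_\<kappa>: "antisym \<kappa>"
  and total_\<kappa>: "total_on (Field \<kappa>) \<kappa>" and refl_\<kappa>: "refl_on (Field \<kappa>) \<kappa>"
  using well_order
  by (auto simp: well_order_on_def linear_order_on_def partial_order_on_def preorder_on_def)

lemma less_trans [trans]: "a \<lless> b \<Longrightarrow> b \<lless> c \<Longrightarrow> a \<lless> c"
  unfolding less_def using trans_\<kappa> antisym_\<kappa> by (meson antisymD transD)

lemma less_asym: "a \<lless> b \<Longrightarrow> \<not> b \<lless> a"
  using less_trans by fastforce

lemma less_linear: "a \<in> Field \<kappa> \<Longrightarrow> b \<in> Field \<kappa> \<Longrightarrow> a \<lless> b \<or> a = b \<or> b \<lless> a"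
  using total_\<kappa> by (auto simp: less_def total_on_def)

lemma uncountable_above:
  assumes "a \<in> Field \<kappa>"
  shows "uncountable {b. a \<lless> b}"
proof
  assume "countable {b. a \<lless> b}"
  then have "countable (insert a {b. a \<lless> b})" by simp
  moreover have "\<exists>b\<in>insert a {b. a \<lless> b}. (c, b) \<in> \<kappa>" if "c \<in> Field \<kappa>" for c
    using less_linear[OF that assms] refl_\<kappa> that by (auto simp: less_def refl_on_def)
  moreover have "insert a {b. a \<lless> b} \<subseteq> Field \<kappa>"
    using assms less_Field by auto
  ultimately show False
    using uncountable_cofinality unfolding countable_cofinality_def by meson
qed

lemma exists_above:
  assumes "a \<in> Field \<kappa>" "finite F"
  obtains b where "a \<lless> b" "b \<notin> F"
  using uncountable_above[OF assms(1)] assms(2)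
  by (metis countable_finite finite_subset mem_Collect_eq subsetI)

subsection \<open>Generators and relations\<close>

abbreviation E :: "('a, 'a \<times> 'a) pre_digraph" where
  "E \<equiv> ordinal_graph \<kappa>"

abbreviation vertex :: "'a \<Rightarrow> (('a, 'a \<times> 'a) generator free_monoid \<Rightarrow>\<^sub>0 'k)" where
  "vertex a \<equiv> letter (Vertex a)"

abbreviation edge :: "'a \<Rightarrow> 'a \<Rightarrow> (('a, 'a \<times> 'a) generator free_monoid \<Rightarrow>\<^sub>0 'k)" where
  "edge a b \<equiv> letter (Edge (a, b))"

abbreviation ghost :: "'a \<Rightarrow> 'a \<Rightarrow> (('a, 'a \<times> 'a) generator free_monoid \<Rightarrow>\<^sub>0 'k)" where
  "ghost a b \<equiv> letter (Ghost (a, b))"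

text \<open>The free unital algebra on the generators of the Leavitt path algebra.\<close>

abbreviation R :: "(('a, 'a \<times> 'a) generator free_monoid \<Rightarrow>\<^sub>0 'k) set" where
  "R \<equiv> unital_polys (generators E)"

lemma verts_E: "verts E = Field \<kappa>" and arcs_E: "e \<in> arcs E \<longleftrightarrow> fst e \<lless> snd e"
  and tail_E: "tail E = fst" and head_E: "head E = snd"
  by (auto simp: ordinal_graph_def less_def)

lemma generators_E [simp]:
  "Vertex a \<in> generators E \<longleftrightarrow> a \<in> Field \<kappa>"
  "Edge (a, b) \<in> generators E \<longleftrightarrow> a \<lless> b"
  "Ghost (a, b) \<in> generators E \<longleftrightarrow> a \<lless> b"
  by (auto simp: generators_def verts_E arcs_E)

lemma generators_cases:
  assumes "g \<in> generators E"
  obtains (Vertex) a where "g = Vertex a" "a \<in> Field \<kappa>"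
    | (Edge) a b where "g = Edge (a, b)" "a \<lless> b"
    | (Ghost) a b where "g = Ghost (a, b)" "a \<lless> b"
  using assms by (auto simp: generators_def verts_E arcs_E)

lemma letters_in_R [simp, intro]:
  "a \<in> Field \<kappa> \<Longrightarrow> vertex a \<in> R"
  "a \<lless> b \<Longrightarrow> edge a b \<in> R"
  "a \<lless> b \<Longrightarrow> ghost a b \<in> R"
  by (auto simp: generators_E)

text \<open>Every vertex emits infinitely many edges, so no relation (CK2) is imposed.\<close>

lemma no_regular_vertex: "v \<in> verts E \<Longrightarrow> infinite (out_arcs E v)"
proof
  assume v: "v \<in> verts E" and "finite (out_arcs E v)"
  then have "finite (snd ` out_arcs E v)" by simp
  moreover have "{b. v \<lless> b} \<subseteq> snd ` out_arcs E v"
    by (force simp: out_arcs_def arcs_E tail_E image_iff)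
  ultimately have "finite {b. v \<lless> b}"
    using finite_subset by blast
  then show False
    using uncountable_above[of v] v by (simp add: verts_E countable_finite)
qed

lemma leavitt_relations_cases:
  assumes "x \<in> leavitt_relations E"
  obtains (VV) a b where "a \<in> Field \<kappa>" "b \<in> Field \<kappa>"
      "x = monomial_of [Vertex a, Vertex b] - (if a = b then monomial_of [Vertex a] else 0)"
    | (VE) a b where "a \<lless> b" "x = monomial_of [Vertex a, Edge (a, b)] - monomial_of [Edge (a, b)]"
    | (EV) a b where "a \<lless> b" "x = monomial_of [Edge (a, b), Vertex b] - monomial_of [Edge (a, b)]"
    | (VG) a b where "a \<lless> b"
        "x = monomial_of [Vertex b, Ghost (a, b)] - monomial_of [Ghost (a, b)]"
    | (GV) a b where "a \<lless> b"
        "x = monomial_of [Ghost (a, b), Vertex a] - monomial_of [Ghost (a, b)]"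
    | (CK1) a b c d where "a \<lless> b" "c \<lless> d"
        "x = monomial_of [Ghost (a, b), Edge (c, d)] -
           (if (a, b) = (c, d) then monomial_of [Vertex b] else 0)"
  using assms unfolding leavitt_relations_def Un_iff mem_Collect_eq
proof (elim disjE exE conjE, goal_cases)
  case (1 v w)
  show ?case by (rule VV[of v w]) (use 1 in \<open>simp_all only: verts_E arcs_E tail_E head_E prod.collapse\<close>)
next
  case (2 e)
  show ?case by (rule VE[of "fst e" "snd e"]) (use 2 in \<open>simp_all only: verts_E arcs_E tail_E head_E prod.collapse\<close>)
next
  case (3 e)
  show ?case by (rule EV[of "fst e" "snd e"]) (use 3 in \<open>simp_all only: verts_E arcs_E tail_E head_E prod.collapse\<close>)
next
  case (4 e)
  show ?case by (rule VG[of "fst e" "snd e"]) (use 4 in \<open>simp_all only: verts_E arcs_E tail_E head_E prod.collapse\<close>)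
next
  case (5 e)
  show ?case by (rule GV[of "fst e" "snd e"]) (use 5 in \<open>simp_all only: verts_E arcs_E tail_E head_E prod.collapse\<close>)
next
  case (6 e f)
  show ?case by (rule CK1[of "fst e" "snd e" "fst f" "snd f"]) (use 6 in \<open>simp_all only: verts_E arcs_E tail_E head_E prod.collapse\<close>)
next
  case (7 v)
  then show ?case using no_regular_vertex by simp
qed

lemma leavitt_relations_closed:
  "(leavitt_relations E :: (('a, 'a \<times> 'a) generator free_monoid \<Rightarrow>\<^sub>0 'k) set)
    \<subseteq> carrier (free_algebra (generators E))"
proof
  fix x :: "('a, 'a \<times> 'a) generator free_monoid \<Rightarrow>\<^sub>0 'k"
  assume "x \<in> leavitt_relations E"
  then show "x \<in> carrier (free_algebra (generators E))"
    by (cases rule: leavitt_relations_cases)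
       (auto simp: carrier_free_algebra_iff monomial_of_pair lookup_minus const_term_mult less_Field)
qed

sublocale presentation "generators E"
  "leavitt_relations E :: (('a, 'a \<times> 'a) generator free_monoid \<Rightarrow>\<^sub>0 'k) set"
  by unfold_locales (rule leavitt_relations_closed)

notation eqv (infix \<open>\<approx>\<^sub>r\<close> 50)

lemma U_eq: "U = unitization (leavitt_path_algebra K E)"
  by (simp add: leavitt_path_algebra_def rel_ideal_def)

lemma eqv_relation:
  "x - y \<in> leavitt_relations E \<Longrightarrow> x \<in> R \<Longrightarrow> y \<in> R \<Longrightarrow> x \<approx>\<^sub>r y"
  by (simp add: eqv_def rel_ideal_generator)

lemma vertex_vertex:
  "a \<in> Field \<kappa> \<Longrightarrow> b \<in> Field \<kappa> \<Longrightarrow>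
    vertex a * vertex b \<approx>\<^sub>r (if a = b then vertex a else 0)"
  by (rule eqv_relation, unfold leavitt_relations_def monomial_of_pair[symmetric],
      rule UnI1, rule UnI1, rule UnI1, rule UnI1, rule UnI1, rule UnI1,
      intro CollectI exI[of _ a] exI[of _ b])
     (auto simp: arcs_E verts_E tail_E head_E less_Field)

lemma vertex_edge_same:
  "a \<lless> b \<Longrightarrow> vertex a * edge a b \<approx>\<^sub>r edge a b"
  by (rule eqv_relation, unfold leavitt_relations_def monomial_of_pair[symmetric],
      rule UnI1, rule UnI1, rule UnI1, rule UnI1, rule UnI1, rule UnI2,
      intro CollectI exI[of _ "(a, b)"])
     (auto simp: arcs_E verts_E tail_E head_E less_Field)

lemma edge_vertex_same:
  "a \<lless> b \<Longrightarrow> edge a b * vertex b \<approx>\<^sub>r edge a b"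
  by (rule eqv_relation, unfold leavitt_relations_def monomial_of_pair[symmetric],
      rule UnI1, rule UnI1, rule UnI1, rule UnI1, rule UnI2,
      intro CollectI exI[of _ "(a, b)"])
     (auto simp: arcs_E verts_E tail_E head_E less_Field)

lemma vertex_ghost_same:
  "a \<lless> b \<Longrightarrow> vertex b * ghost a b \<approx>\<^sub>r ghost a b"
  by (rule eqv_relation, unfold leavitt_relations_def monomial_of_pair[symmetric],
      rule UnI1, rule UnI1, rule UnI1, rule UnI2,
      intro CollectI exI[of _ "(a, b)"])
     (auto simp: arcs_E verts_E tail_E head_E less_Field)

lemma ghost_vertex_same:
  "a \<lless> b \<Longrightarrow> ghost a b * vertex a \<approx>\<^sub>r ghost a b"
  by (rule eqv_relation, unfold leavitt_relations_def monomial_of_pair[symmetric],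
      rule UnI1, rule UnI1, rule UnI2,
      intro CollectI exI[of _ "(a, b)"])
     (auto simp: arcs_E verts_E tail_E head_E less_Field)

lemma ghost_edge:
  "a \<lless> b \<Longrightarrow> c \<lless> d \<Longrightarrow>
    ghost a b * edge c d \<approx>\<^sub>r (if (a, b) = (c, d) then vertex b else 0)"
  by (rule eqv_relation, unfold leavitt_relations_def monomial_of_pair[symmetric],
      rule UnI1, rule UnI2,
      intro CollectI exI[of _ "(a, b)"] exI[of _ "(c, d)"])
     (auto simp: arcs_E verts_E tail_E head_E less_Field)

text \<open>The remaining products of a vertex with an edge or ghost edge are consequences.\<close>

lemma absorb_l:
  assumes "a \<in> Field \<kappa>" "c \<in> Field \<kappa>" "vertex a * x \<approx>\<^sub>r x"
  shows "vertex c * x \<approx>\<^sub>r (if c = a then x else 0)"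
proof (cases "c = a")
  case False
  note x = eqv_polys(2)[OF assms(3)]
  have "vertex c * x \<approx>\<^sub>r vertex c * (vertex a * x)"
    by (rule eqv_mult_l[OF eqv_sym[OF assms(3)]]) (use assms in auto)
  also have "\<dots> = vertex c * vertex a * x" by (simp add: mult.assoc)
  also have "\<dots> \<approx>\<^sub>r 0 * x"
    using eqv_mult_r[OF vertex_vertex[OF assms(2,1)] x] False by simp
  finally show ?thesis using False by simp
qed (use assms in simp)

lemma absorb_r:
  assumes "a \<in> Field \<kappa>" "c \<in> Field \<kappa>" "x * vertex a \<approx>\<^sub>r x"
  shows "x * vertex c \<approx>\<^sub>r (if c = a then x else 0)"
proof (cases "c = a")
  case False
  note x = eqv_polys(2)[OF assms(3)]
  have "x * vertex c \<approx>\<^sub>r x * vertex a * vertex c"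
    by (rule eqv_mult_r[OF eqv_sym[OF assms(3)]]) (use assms in auto)
  also have "\<dots> = x * (vertex a * vertex c)" by (simp add: mult.assoc)
  also have "\<dots> \<approx>\<^sub>r x * 0"
    using eqv_mult_l[OF vertex_vertex[OF assms(1,2)] x] False by simp
  finally show ?thesis using False by simp
qed (use assms in simp)

subsection \<open>Paths\<close>

text \<open>
  A path is a nonempty strictly increasing list of vertices. It determines a product of edges and
  a product of ghost edges; both carry the vertex at the end of the path as an extra factor, so
  that paths of length zero need no separate treatment.
\<close>

fun path :: "'a list \<Rightarrow> bool" where
  "path [] \<longleftrightarrow> False"
| "path [a] \<longleftrightarrow> a \<in> Field \<kappa>"
| "path (a # b # p) \<longleftrightarrow> a \<lless> b \<and> path (b # p)"

fun real_path :: "'a list \<Rightarrow> (('a, 'a \<times> 'a) generator free_monoid \<Rightarrow>\<^sub>0 'k)" where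
  "real_path [] = 0"
| "real_path [a] = vertex a"
| "real_path (a # b # p) = edge a b * real_path (b # p)"

fun ghost_path :: "'a list \<Rightarrow> (('a, 'a \<times> 'a) generator free_monoid \<Rightarrow>\<^sub>0 'k)" where
  "ghost_path [] = 0"
| "ghost_path [a] = vertex a"
| "ghost_path (a # b # p) = ghost_path (b # p) * ghost a b"

lemma path_nonempty: "path p \<Longrightarrow> p \<noteq> []"
  by auto

lemma path_hd_Field: "path p \<Longrightarrow> hd p \<in> Field \<kappa>"
  by (cases p rule: path.cases) (auto simp: less_Field)

lemma path_last_Field: "path p \<Longrightarrow> last p \<in> Field \<kappa>"
  by (induction p rule: path.induct) auto

lemma path_hd_last: "path p \<Longrightarrow> p = [hd p] \<or> hd p \<lless> last p"
  by (induction p rule: path.induct) (auto intro: less_trans)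

lemma path_append:
  "path p \<Longrightarrow> path t \<Longrightarrow> hd t = last p \<Longrightarrow>
    path (p @ tl t) \<and> last (p @ tl t) = last t \<and> hd (p @ tl t) = hd p"
proof (induction p rule: path.induct)
  case (2 a)
  then show ?case by (cases t) auto
qed auto

lemma real_path_R [simp]: "path p \<Longrightarrow> real_path p \<in> R"
  by (induction p rule: path.induct) auto

lemma ghost_path_R [simp]: "path p \<Longrightarrow> ghost_path p \<in> R"
  by (induction p rule: path.induct) auto

lemma vertex_real_path:
  assumes "path p" "a \<in> Field \<kappa>"
  shows "vertex a * real_path p \<approx>\<^sub>r (if a = hd p then real_path p else 0)"
proof (rule absorb_l[OF path_hd_Field[OF assms(1)] assms(2)])
  show "vertex (hd p) * real_path p \<approx>\<^sub>r real_path p"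
  proof (cases p rule: path.cases)
    case (2 c)
    then show ?thesis using vertex_vertex[of c c] assms by simp
  next
    case (3 c d q)
    then show ?thesis
      using eqv_mult_r[OF vertex_edge_same[of c d], of "real_path (d # q)"] assms
      by (simp add: mult.assoc)
  qed (use assms in simp)
qed

lemma ghost_path_vertex:
  assumes "path p" "a \<in> Field \<kappa>"
  shows "ghost_path p * vertex a \<approx>\<^sub>r (if a = hd p then ghost_path p else 0)"
proof (rule absorb_r[OF path_hd_Field[OF assms(1)] assms(2)])
  show "ghost_path p * vertex (hd p) \<approx>\<^sub>r ghost_path p"
  proof (cases p rule: path.cases)
    case (2 c)
    then show ?thesis using vertex_vertex[of c c] assms by simp
  next
    case (3 c d q)
    then show ?thesis
      using eqv_mult_l[OF ghost_vertex_same[of c d], of "ghost_path (d # q)"] assms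
      by (simp add: mult.assoc)
  qed (use assms in simp)
qed

lemma real_path_last: "path p \<Longrightarrow> real_path p * vertex (last p) \<approx>\<^sub>r real_path p"
proof (induction p rule: path.induct)
  case (2 a)
  then show ?case using vertex_vertex[of a a] by simp
next
  case (3 a b p)
  then show ?case
    using eqv_mult_l[of "real_path (b # p) * vertex (last (b # p))" "real_path (b # p)" "edge a b"]
    by (simp add: mult.assoc)
qed simp

lemma ghost_path_last: "path p \<Longrightarrow> vertex (last p) * ghost_path p \<approx>\<^sub>r ghost_path p"
proof (induction p rule: path.induct)
  case (2 a)
  then show ?case using vertex_vertex[of a a] by simp
next
  case (3 a b p)
  then show ?case
    using eqv_mult_r[of "vertex (last (b # p)) * ghost_path (b # p)" "ghost_path (b # p)" "ghost a b"]
    by (simp add: mult.assoc)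
qed simp

lemma real_path_append:
  "path p \<Longrightarrow> path t \<Longrightarrow> hd t = last p \<Longrightarrow> real_path p * real_path t \<approx>\<^sub>r real_path (p @ tl t)"
proof (induction p rule: path.induct)
  case (2 a)
  then have "t = a # tl t" by (cases t) auto
  then show ?case using vertex_real_path[of t a] 2 by simp
next
  case (3 a b p)
  then show ?case
    using eqv_mult_l[of "real_path (b # p) * real_path t" "real_path ((b # p) @ tl t)" "edge a b"]
    by (simp add: mult.assoc)
qed simp

lemma ghost_path_append:
  "path p \<Longrightarrow> path t \<Longrightarrow> hd t = last p \<Longrightarrow>
    ghost_path t * ghost_path p \<approx>\<^sub>r ghost_path (p @ tl t)"
proof (induction p rule: path.induct)
  case (2 a)
  then have "t = a # tl t" by (cases t) auto
  then show ?case using ghost_path_vertex[of t a] 2 by simp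
next
  case (3 a b p)
  then show ?case
    using eqv_mult_r[of "ghost_path t * ghost_path (b # p)" "ghost_path ((b # p) @ tl t)" "ghost a b"]
    by (simp add: mult.assoc)
qed simp

text \<open>One step of the multiplication of a ghost path with a path: compare the first edges.\<close>

lemma ghost_path_real_path_step:
  assumes "path (a # b # q)" "path (c # d # r)"
  shows "ghost_path (a # b # q) * real_path (c # d # r) \<approx>\<^sub>r
    (if a = c \<and> b = d then ghost_path (b # q) * real_path (d # r) else 0)"
proof -
  let ?Q = "ghost_path (b # q)" and ?P = "real_path (d # r)"
  have "ghost_path (a # b # q) * real_path (c # d # r) = ?Q * (ghost a b * edge c d * ?P)"
    by (simp add: mult.assoc)
  also have "\<dots> \<approx>\<^sub>r ?Q * ((if (a, b) = (c, d) then vertex b else 0) * ?P)"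
    by (intro eqv_mult_l eqv_mult_r ghost_edge) (use assms in auto)
  finally have *: "ghost_path (a # b # q) * real_path (c # d # r) \<approx>\<^sub>r
      ?Q * ((if (a, b) = (c, d) then vertex b else 0) * ?P)" .
  show ?thesis
  proof (cases "a = c \<and> b = d")
    case True
    have "?Q * (vertex b * ?P) \<approx>\<^sub>r ?Q * ?P"
      by (rule eqv_mult_l) (use True assms vertex_real_path[of "d # r" b] in \<open>auto simp: less_Field\<close>)
    then show ?thesis using * True eqv_trans by auto
  next
    case False
    then show ?thesis using * by auto
  qed
qed

text \<open>
  Of two paths with \<open>q\<^sup>* r \<noteq> 0\<close>, one is an initial segment of the other, and the product is the
  remaining piece.
\<close>

lemma ghost_path_real_path:
  "path q \<Longrightarrow> path r \<Longrightarrow>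
    ghost_path q * real_path r \<approx>\<^sub>r 0 \<or>
    (\<exists>t. path t \<and> hd t = last q \<and> last t = last r \<and> ghost_path q * real_path r \<approx>\<^sub>r real_path t) \<or>
    (\<exists>t. path t \<and> hd t = last r \<and> last t = last q \<and> ghost_path q * real_path r \<approx>\<^sub>r ghost_path t)"
proof (induction q arbitrary: r rule: path.induct)
  case (2 a)
  then show ?case using vertex_real_path[of r a] by (auto split: if_splits)
next
  case (3 a b q)
  show ?case
  proof (cases r rule: path.cases)
    case (2 c)
    then show ?thesis
      using ghost_path_vertex[of "a # b # q" c] "3.prems" exI[of _ "a # b # q"]
      by (cases "c = a") auto
  next
    case (3 c d r')
    show ?thesis
    proof (cases "a = c \<and> b = d")
      case True
      have *: "ghost_path (a # b # q) * real_path r \<approx>\<^sub>r ghost_path (b # q) * real_path (d # r')"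
        using ghost_path_real_path_step[of a b q c d r'] \<open>path (a # b # q)\<close> \<open>path r\<close> True 3 by auto
      have "path (b # q)" "path (d # r')" "last (b # q) = last (a # b # q)" "last (d # r') = last r"
        using \<open>path (a # b # q)\<close> \<open>path r\<close> 3 by auto
      then show ?thesis
        using "3.IH"[of "d # r'"] eqv_trans[OF *] by metis
    next
      case False
      then show ?thesis
        using ghost_path_real_path_step[of a b q c d r'] \<open>path (a # b # q)\<close> \<open>path r\<close> 3 by auto
    qed
  qed (use "3.prems" in simp)
qed simp

text \<open>Paths that end at the same vertex behave like matrix units.\<close>

lemma ghost_path_real_path_same:
  "path q \<Longrightarrow> path r \<Longrightarrow> last q = last r \<Longrightarrow>
    ghost_path q * real_path r \<approx>\<^sub>r (if q = r then vertex (last q) else 0)"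
proof (induction q arbitrary: r rule: path.induct)
  case (2 a)
  show ?case
  proof (cases "hd r = a")
    case True
    then have "r = [a]" using path_hd_last[of r] 2 by auto
    then show ?thesis using vertex_vertex[of a a] 2 by simp
  next
    case False
    then have "r \<noteq> [a]" by auto
    then show ?thesis using vertex_real_path[of r a] 2 False by auto
  qed
next
  case (3 a b q)
  show ?case
  proof (cases r rule: path.cases)
    case (2 c)
    have "a \<noteq> c"
      using path_hd_last[of "a # b # q"] "3.prems" 2 by auto
    then show ?thesis
      using ghost_path_vertex[of "a # b # q" c] "3.prems" 2 by auto
  next
    case (3 c d r')
    show ?thesis
    proof (cases "a = c \<and> b = d")
      case True
      have *: "ghost_path (a # b # q) * real_path r \<approx>\<^sub>r ghost_path (b # q) * real_path (d # r')"
        using ghost_path_real_path_step[of a b q c d r'] \<open>path (a # b # q)\<close> \<open>path r\<close> True 3 by auto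
      show ?thesis
        using eqv_trans[OF * "3.IH"[of "d # r'"]] "3.prems" 3 True by auto
    next
      case False
      then show ?thesis
        using ghost_path_real_path_step[of a b q c d r'] \<open>path (a # b # q)\<close> \<open>path r\<close> 3 by auto
    qed
  qed (use "3.prems" in simp)
qed simp

subsection \<open>Subspaces spanned by monomials\<close>

text \<open>
  The linear span of the monomials \<open>p q\<^sup>*\<close> for paths \<open>p\<close>, \<open>q\<close> with common end in \<open>W\<close>, as a set of
  polynomials that contains the ideal of relations.
\<close>

inductive_set mspan :: "'a set \<Rightarrow> (('a, 'a \<times> 'a) generator free_monoid \<Rightarrow>\<^sub>0 'k) set" for W where
  mspan_rel: "x \<in> rel_ideal \<Longrightarrow> x \<in> mspan W"
| mspan_monomial: "\<lbrakk>path p; path q; last p = last q; last q \<in> W\<rbrakk> \<Longrightarrow> real_path p * ghost_path q \<in> mspan W"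
| mspan_add: "\<lbrakk>x \<in> mspan W; y \<in> mspan W\<rbrakk> \<Longrightarrow> x + y \<in> mspan W"
| mspan_const: "x \<in> mspan W \<Longrightarrow> const k * x \<in> mspan W"

lemma mspan_R: "x \<in> mspan W \<Longrightarrow> x \<in> R"
  by (induction rule: mspan.induct) (auto simp: rel_ideal_polys)

lemma mspan_zero [simp]: "0 \<in> mspan W"
  by (rule mspan_rel) simp

lemma mspan_uminus: "x \<in> mspan W \<Longrightarrow> - x \<in> mspan W"
  using mspan_const[of x W "- 1"] by (simp add: single_uminus)

lemma mspan_diff: "x \<in> mspan W \<Longrightarrow> y \<in> mspan W \<Longrightarrow> x - y \<in> mspan W"
  using mspan_add[of x W "- y"] mspan_uminus[of y W] by simp

lemma mspan_sum: "(\<And>i. i \<in> A \<Longrightarrow> f i \<in> mspan W) \<Longrightarrow> sum f A \<in> mspan W"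
  by (induction A rule: infinite_finite_induct) (auto intro: mspan_add)

lemma mspan_eqv: "y \<approx>\<^sub>r x \<Longrightarrow> x \<in> mspan W \<Longrightarrow> y \<in> mspan W"
  using mspan_add[OF mspan_rel[of "y - x" W], of x] by (simp add: eqv_def)

lemma mspan_mult_monomials:
  assumes pq: "path p" "path q" "last p = last q" "last q \<in> V"
    and rs: "path r" "path s" "last r = last s" "last s \<in> W"
    and max: "\<And>v w. v \<in> V \<Longrightarrow> w \<in> W \<Longrightarrow> (\<not> w \<lless> v \<longrightarrow> w \<in> Z) \<and> (\<not> v \<lless> w \<longrightarrow> v \<in> Z)"
  shows "real_path p * ghost_path q * (real_path r * ghost_path s) \<in> mspan Z"
proof -
  have eq: "real_path p * ghost_path q * (real_path r * ghost_path s)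
      = real_path p * (ghost_path q * real_path r) * ghost_path s"
    by (simp add: mult.assoc)
  consider "ghost_path q * real_path r \<approx>\<^sub>r 0"
    | t where "path t" "hd t = last q" "last t = last r" "ghost_path q * real_path r \<approx>\<^sub>r real_path t"
    | t where "path t" "hd t = last r" "last t = last q" "ghost_path q * real_path r \<approx>\<^sub>r ghost_path t"
    using ghost_path_real_path[OF pq(2) rs(1)] by blast
  then show ?thesis
  proof cases
    case 1
    have "real_path p * (ghost_path q * real_path r) * ghost_path s
        \<approx>\<^sub>r real_path p * 0 * ghost_path s"
      by (intro eqv_mult_r eqv_mult_l 1) (use pq rs in auto)
    then show ?thesis unfolding eq by (rule mspan_eqv) simp
  next
    case (2 t)
    have t: "path (p @ tl t)" "last (p @ tl t) = last t"
      using path_append[of p t] pq 2 by auto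
    have "real_path p * (ghost_path q * real_path r) * ghost_path s
        \<approx>\<^sub>r real_path p * real_path t * ghost_path s"
      by (intro eqv_mult_r eqv_mult_l 2) (use pq rs in auto)
    also have "\<dots> \<approx>\<^sub>r real_path (p @ tl t) * ghost_path s"
      by (intro eqv_mult_r real_path_append) (use pq rs 2 in auto)
    finally show ?thesis unfolding eq
    proof (rule mspan_eqv)
      have "\<not> last s \<lless> last q"
        using path_hd_last[of t] 2 rs less_asym by (cases t) auto
      then show "real_path (p @ tl t) * ghost_path s \<in> mspan Z"
        using max[OF pq(4) rs(4)] t 2 rs by (intro mspan_monomial) auto
    qed
  next
    case (3 t)
    have t: "path (s @ tl t)" "last (s @ tl t) = last t"
      using path_append[of s t] rs 3 by auto
    have "real_path p * (ghost_path q * real_path r) * ghost_path s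
        \<approx>\<^sub>r real_path p * ghost_path t * ghost_path s"
      by (intro eqv_mult_r eqv_mult_l 3) (use pq rs in auto)
    also have "\<dots> = real_path p * (ghost_path t * ghost_path s)" by (simp add: mult.assoc)
    also have "\<dots> \<approx>\<^sub>r real_path p * ghost_path (s @ tl t)"
      by (intro eqv_mult_l ghost_path_append) (use pq rs 3 in auto)
    finally show ?thesis unfolding eq
    proof (rule mspan_eqv)
      have "\<not> last q \<lless> last s"
        using path_hd_last[of t] 3 rs less_asym by (cases t) auto
      then show "real_path p * ghost_path (s @ tl t) \<in> mspan Z"
        using max[OF pq(4) rs(4)] t 3 pq by (intro mspan_monomial) auto
    qed
  qed
qed

text \<open>The end of a nonzero product of monomials is the larger one of the two ends.\<close>

lemma mspan_mult:
  assumes x: "x \<in> mspan V" and y: "y \<in> mspan W"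
    and max: "\<And>v w. v \<in> V \<Longrightarrow> w \<in> W \<Longrightarrow> (\<not> w \<lless> v \<longrightarrow> w \<in> Z) \<and> (\<not> v \<lless> w \<longrightarrow> v \<in> Z)"
  shows "x * y \<in> mspan Z"
  using x
proof (induction rule: mspan.induct)
  case (mspan_rel x)
  then show ?case using mspan_R[OF y] by (auto intro: mspan.mspan_rel rel_ideal_mult_r)
next
  case (mspan_monomial p q)
  note pq = mspan_monomial
  show ?case using y
  proof (induction rule: mspan.induct)
    case (mspan_rel x)
    then show ?case using pq by (intro mspan.mspan_rel rel_ideal_mult_l unital_polys_mult) auto
  next
    case (mspan_monomial r s)
    show ?case by (rule mspan_mult_monomials[OF pq mspan_monomial max])
  next
    case (mspan_add x y)
    then show ?case by (auto simp: distrib_left intro: mspan.mspan_add)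
  next
    case (mspan_const x k)
    then show ?case by (auto simp: const_left_commute[of _ k] intro: mspan.mspan_const)
  qed
next
  case (mspan_add x y)
  then show ?case by (auto simp: distrib_right intro: mspan.mspan_add)
next
  case (mspan_const x k)
  then show ?case by (auto simp: mult.assoc intro: mspan.mspan_const)
qed

lemma generators_in_mspan:
  assumes "g \<in> generators E"
  shows "letter g \<in> mspan (Field \<kappa>)"
  using assms
proof (cases rule: generators_cases)
  case (Vertex a)
  have "real_path [a] * ghost_path [a] \<in> mspan (Field \<kappa>)"
    by (rule mspan_monomial) (use Vertex in auto)
  moreover have "vertex a \<approx>\<^sub>r real_path [a] * ghost_path [a]"
    using eqv_sym[OF vertex_vertex[of a a]] Vertex by simp
  ultimately show ?thesis using Vertex mspan_eqv by blast
next
  case (Edge a b)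
  have "real_path [a, b] * ghost_path [b] \<in> mspan (Field \<kappa>)"
    by (rule mspan_monomial) (use Edge in \<open>auto simp: less_Field\<close>)
  moreover have "real_path [a, b] * ghost_path [b] \<approx>\<^sub>r edge a b"
    using eqv_trans[OF eqv_mult_r[OF edge_vertex_same[of a b], of "vertex b"] edge_vertex_same[of a b]]
      Edge by (simp add: less_Field)
  ultimately show ?thesis using Edge mspan_eqv eqv_sym by blast
next
  case (Ghost a b)
  have "real_path [b] * ghost_path [a, b] \<in> mspan (Field \<kappa>)"
    by (rule mspan_monomial) (use Ghost in \<open>auto simp: less_Field\<close>)
  moreover have "real_path [b] * ghost_path [a, b] \<approx>\<^sub>r ghost a b"
    using eqv_trans[OF eqv_mult_l[OF vertex_ghost_same[of a b], of "vertex b"] vertex_ghost_same[of a b]]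
      Ghost by (simp add: less_Field)
  ultimately show ?thesis using Ghost mspan_eqv eqv_sym by blast
qed

text \<open>The monomials span the nonunital algebra.\<close>

lemma mspan_Field: "x \<in> R \<Longrightarrow> x - const (const_term x) \<in> mspan (Field \<kappa>)"
proof (induction rule: unital_polys_induct)
  case one
  then show ?case by (simp add: lookup_one)
next
  case (add x y)
  then show ?case
    using mspan_add[of "x - const (const_term x)" _ "y - const (const_term y)"]
    by (simp add: lookup_add const_add[symmetric] algebra_simps)
next
  case (const k x)
  then show ?case
    using mspan_const[of "x - const (const_term x)" _ k]
    by (simp add: const_term_mult const_mult[symmetric] algebra_simps)
next
  case (letter a x)
  have "letter a * (x - const (const_term x)) \<in> mspan (Field \<kappa>)"
    by (rule mspan_mult[OF generators_in_mspan[OF letter(1)] letter(3)]) auto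
  moreover have "const (const_term x) * letter a \<in> mspan (Field \<kappa>)"
    by (rule mspan_const[OF generators_in_mspan[OF letter(1)]])
  moreover have "letter a * x - const (const_term (letter a * x)) =
      letter a * (x - const (const_term x)) + const (const_term x) * letter a"
    by (simp add: const_term_mult right_diff_distrib const_commute[of "letter a"])
  ultimately show ?case
    by (metis mspan_add)
qed

lemma mspan_Field': "x \<in> R \<Longrightarrow> const_term x = 0 \<Longrightarrow> x \<in> mspan (Field \<kappa>)"
  using mspan_Field[of x] by simp

end

section \<open>Vertices are nonzero\<close>

text \<open>
  Generators act by partial maps on paths: a vertex fixes the paths that start there, an edge is
  prepended, and a ghost edge removes the first edge. The empty list stands for an undefined value.
\<close>

fun act :: "('a, 'a \<times> 'a) generator \<Rightarrow> 'a list \<Rightarrow> 'a list" where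
  "act (Vertex v) q = (if q \<noteq> [] \<and> hd q = v then q else [])"
| "act (Edge e) q = (if q \<noteq> [] \<and> hd q = snd e then fst e # q else [])"
| "act (Ghost e) q = (if tl q \<noteq> [] \<and> hd q = fst e \<and> hd (tl q) = snd e then tl q else [])"

definition act_word :: "('a, 'a \<times> 'a) generator free_monoid \<Rightarrow> 'a list \<Rightarrow> 'a list" where
  "act_word w = foldr act (letters w)"

lemma act_Nil [simp]: "act g [] = []"
  by (cases g) auto

lemma act_word_Nil [simp]: "act_word w [] = []"
proof -
  have "foldr act xs [] = []" for xs :: "('a, 'a \<times> 'a) generator list"
    by (induction xs) auto
  then show ?thesis by (simp add: act_word_def)
qed

lemma act_word_plus: "act_word (u + v) q = act_word u (act_word v q)"
  by (simp add: act_word_def)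

context leavitt_ordinal
begin

text \<open>
  The relations hold for this action. The claim for all \<open>g\<close> and \<open>q\<close> at once is stable
  under multiplication from both sides.
\<close>

lemma rel_ideal_acts_zero:
  assumes "x \<in> rel_ideal" "g [] = 0"
  shows "linear_ext (\<lambda>w. g (act_word w q)) x = 0"
  using assms
proof (induction arbitrary: g q rule: rel_ideal_induct)
  case (generator x)
  then show ?case
    by (cases rule: leavitt_relations_cases) (auto simp: linear_ext_diff act_word_def)
next
  case (const k x)
  then show ?case by (simp add: linear_ext_const_mult)
next
  case (mult_l a x)
  have "linear_ext (\<lambda>w. g (act_word w q)) (a * x)
      = linear_ext (\<lambda>u. linear_ext (\<lambda>v. (\<lambda>p. g (act_word u p)) (act_word v q)) x) a"
    by (simp add: linear_ext_mult act_word_plus)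
  also have "\<dots> = linear_ext (\<lambda>u. 0) a"
    by (intro arg_cong[of _ _ "\<lambda>f. linear_ext f a"] ext mult_l) (simp add: mult_l)
  finally show ?case by (simp add: linear_ext_def)
next
  case (mult_r a x)
  have "linear_ext (\<lambda>w. g (act_word w q)) (x * a)
      = linear_ext (\<lambda>v. linear_ext (\<lambda>u. g (act_word u (act_word v q))) x) a"
    by (simp add: linear_ext_mult act_word_plus) (rule linear_ext_swap)
  also have "\<dots> = linear_ext (\<lambda>v. 0) a"
    by (intro arg_cong[of _ _ "\<lambda>f. linear_ext f a"] ext mult_r)
  finally show ?case by (simp add: linear_ext_def)
qed (auto simp: linear_ext_add)

lemma vertex_nonzero: "\<not> vertex a \<approx>\<^sub>r 0"
proof
  assume "vertex a \<approx>\<^sub>r 0"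
  then have "linear_ext (\<lambda>w. (\<lambda>p. if p = [a] then 1 else 0) (act_word w [a])) (vertex a) = 0"
    by (intro rel_ideal_acts_zero) (simp_all add: eqv_zero_iff)
  then show False by (simp add: act_word_def)
qed

section \<open>Local finiteness\<close>

text \<open>
  An element meets only finitely many vertices, and if its monomials all end beyond \<open>u\<close>, then it
  meets only finitely many of the edges that start at \<open>u\<close>.
\<close>

lemma finite_vertices:
  assumes "x \<in> mspan W"
  shows "finite {a \<in> Field \<kappa>. \<not> vertex a * x \<approx>\<^sub>r 0}"
  using assms
proof (induction rule: mspan.induct)
  case (mspan_rel x)
  then have "{a \<in> Field \<kappa>. \<not> vertex a * x \<approx>\<^sub>r 0} = {}"
    by (auto simp: eqv_zero_iff rel_ideal_mult_l)
  then show ?case by (simp only: finite.emptyI)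
next
  case (mspan_monomial p q)
  have "vertex a * (real_path p * ghost_path q) \<approx>\<^sub>r 0" if "a \<in> Field \<kappa>" "a \<noteq> hd p" for a
    using eqv_mult_r[OF vertex_real_path[of p a], of "ghost_path q"] mspan_monomial that
    by (simp add: mult.assoc)
  then have "{a \<in> Field \<kappa>. \<not> vertex a * (real_path p * ghost_path q) \<approx>\<^sub>r 0} \<subseteq> {hd p}"
    by auto
  then show ?case by (rule finite_subset) simp
next
  case (mspan_add x y)
  have "vertex a * (x + y) \<approx>\<^sub>r 0" if "vertex a * x \<approx>\<^sub>r 0" "vertex a * y \<approx>\<^sub>r 0" for a
    using eqv_add[OF that] by (simp add: distrib_left)
  then have "{a \<in> Field \<kappa>. \<not> vertex a * (x + y) \<approx>\<^sub>r 0} \<subseteq>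
      {a \<in> Field \<kappa>. \<not> vertex a * x \<approx>\<^sub>r 0} \<union> {a \<in> Field \<kappa>. \<not> vertex a * y \<approx>\<^sub>r 0}"
    by auto
  then show ?case by (rule finite_subset) (simp add: mspan_add)
next
  case (mspan_const x k)
  have "vertex a * (const k * x) \<approx>\<^sub>r 0" if "vertex a * x \<approx>\<^sub>r 0" for a
    using eqv_const[OF that, of k] by (simp add: const_left_commute[of _ k])
  then have "{a \<in> Field \<kappa>. \<not> vertex a * (const k * x) \<approx>\<^sub>r 0} \<subseteq>
      {a \<in> Field \<kappa>. \<not> vertex a * x \<approx>\<^sub>r 0}"
    by auto
  then show ?case by (rule finite_subset) (rule mspan_const)
qed

lemma ghost_real_path_zero:
  assumes p: "path p" and u: "u \<lless> last p" "u \<lless> b" and b: "b \<noteq> hd (tl p)"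
  shows "ghost u b * real_path p \<approx>\<^sub>r 0"
proof (cases p rule: path.cases)
  case (2 c)
  then have "c \<noteq> u" using u by auto
  then show ?thesis
    using absorb_r[OF _ _ ghost_vertex_same[OF u(2)], of c] p u less_Field[OF u(2)] 2 by auto
next
  case (3 c d r)
  have "ghost u b * edge c d * real_path (d # r) \<approx>\<^sub>r 0 * real_path (d # r)"
    by (rule eqv_mult_r) (use ghost_edge[of u b c d] p u b 3 in auto)
  then show ?thesis using 3 by (simp add: mult.assoc)
qed (use p in simp)

lemma finite_edges:
  assumes "x \<in> mspan {w. u \<lless> w}"
  shows "finite {b. u \<lless> b \<and> \<not> ghost u b * x \<approx>\<^sub>r 0}"
  using assms
proof (induction rule: mspan.induct)
  case (mspan_rel x)
  then have "{b. u \<lless> b \<and> \<not> ghost u b * x \<approx>\<^sub>r 0} = {}"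
    by (auto simp: eqv_zero_iff rel_ideal_mult_l)
  then show ?case by (simp only: finite.emptyI)
next
  case (mspan_monomial p q)
  have "ghost u b * (real_path p * ghost_path q) \<approx>\<^sub>r 0" if "u \<lless> b" "b \<noteq> hd (tl p)" for b
    using eqv_mult_r[OF ghost_real_path_zero[of p u b], of "ghost_path q"] mspan_monomial that
    by (simp add: mult.assoc)
  then have "{b. u \<lless> b \<and> \<not> ghost u b * (real_path p * ghost_path q) \<approx>\<^sub>r 0} \<subseteq> {hd (tl p)}"
    by auto
  then show ?case by (rule finite_subset) simp
next
  case (mspan_add x y)
  have "ghost u b * (x + y) \<approx>\<^sub>r 0" if "ghost u b * x \<approx>\<^sub>r 0" "ghost u b * y \<approx>\<^sub>r 0" for b
    using eqv_add[OF that] by (simp add: distrib_left)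
  then have "{b. u \<lless> b \<and> \<not> ghost u b * (x + y) \<approx>\<^sub>r 0} \<subseteq>
      {b. u \<lless> b \<and> \<not> ghost u b * x \<approx>\<^sub>r 0} \<union> {b. u \<lless> b \<and> \<not> ghost u b * y \<approx>\<^sub>r 0}"
    by auto
  then show ?case by (rule finite_subset) (simp add: mspan_add)
next
  case (mspan_const x k)
  have "ghost u b * (const k * x) \<approx>\<^sub>r 0" if "ghost u b * x \<approx>\<^sub>r 0" for b
    using eqv_const[OF that, of k] by (simp add: const_left_commute[of _ k])
  then have "{b. u \<lless> b \<and> \<not> ghost u b * (const k * x) \<approx>\<^sub>r 0} \<subseteq>
      {b. u \<lless> b \<and> \<not> ghost u b * x \<approx>\<^sub>r 0}"
    by auto
  then show ?case by (rule finite_subset) (rule mspan_const)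
qed

lemma Field_nonempty: obtains a where "a \<in> Field \<kappa>"
proof -
  have "Field \<kappa> \<noteq> {}"
  proof
    assume "Field \<kappa> = {}"
    then have "countable_cofinality \<kappa>"
      by (auto simp: countable_cofinality_def intro!: exI[of _ "{}"])
    then show False using uncountable_cofinality by simp
  qed
  then show thesis using that by auto
qed

lemma exists_minimal:
  assumes "A \<subseteq> Field \<kappa>" "A \<noteq> {}"
  obtains m where "m \<in> A" "\<And>a. a \<in> A \<Longrightarrow> a = m \<or> m \<lless> a"
proof -
  have "wf (\<kappa> - Id)" using well_order by (simp add: well_order_on_def)
  then obtain m where m: "m \<in> A" "\<And>a. (a, m) \<in> \<kappa> - Id \<Longrightarrow> a \<notin> A"
    using assms(2) wfE_min[of "\<kappa> - Id"] by (metis all_not_in_conv)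
  show thesis
  proof (rule that[OF m(1)])
    fix a assume "a \<in> A"
    moreover from this have "\<not> a \<lless> m" using m(2)[of a] by (auto simp: less_def)
    ultimately show "a = m \<or> m \<lless> a" using less_linear[of a m] m(1) assms(1) by auto
  qed
qed

section \<open>Linear combinations of monomials\<close>

text \<open>The index set of the monomials \<open>p q\<^sup>*\<close> whose common end lies in \<open>W\<close>.\<close>

definition monomials :: "'a set \<Rightarrow> ('a list \<times> 'a list) set" where
  "monomials W = {(p, q). path p \<and> path q \<and> last p = last q \<and> last q \<in> W}"

text \<open>The monomial \<open>p q\<^sup>*\<close> of a pair \<open>(p, q)\<close> of paths.\<close>

definition monomial :: "'a list \<times> 'a list \<Rightarrow> (('a, 'a \<times> 'a) generator free_monoid \<Rightarrow>\<^sub>0 'k)" where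
  "monomial k = real_path (fst k) * ghost_path (snd k)"

lemma monomial_mspan: "k \<in> monomials W \<Longrightarrow> monomial k \<in> mspan W"
  by (auto simp: monomials_def monomial_def intro: mspan_monomial)

lemma monomial_R [simp]: "k \<in> monomials W \<Longrightarrow> monomial k \<in> R"
  using monomial_mspan mspan_R by blast

lemma mspan_combination:
  assumes "x \<in> mspan W"
  obtains S c where "finite S" "S \<subseteq> monomials W" "\<And>k. k \<notin> S \<Longrightarrow> c k = 0"
    "x \<approx>\<^sub>r (\<Sum>k\<in>S. const (c k) * monomial k)"
proof -
  have "\<exists>S c. finite S \<and> S \<subseteq> monomials W \<and> (\<forall>k. k \<notin> S \<longrightarrow> c k = 0) \<and>
      x \<approx>\<^sub>r (\<Sum>k\<in>S. const (c k) * monomial k)"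
    using assms
  proof (induction rule: mspan.induct)
    case (mspan_rel x)
    then show ?case
      by (intro exI[of _ "{}"] exI[of _ "\<lambda>_. 0"]) (simp add: eqv_zero_iff)
  next
    case (mspan_monomial p q)
    then have "(p, q) \<in> monomials W" by (simp add: monomials_def)
    moreover from this have "real_path p * ghost_path q \<approx>\<^sub>r monomial (p, q)"
      using mspan_monomial by (simp add: monomial_def)
    ultimately show ?case
      by (intro exI[of _ "{(p, q)}"] exI[of _ "\<lambda>k. if k = (p, q) then 1 else 0"]) simp
  next
    case (mspan_add x y)
    from mspan_add.IH obtain S c T d where
      S: "finite S" "S \<subseteq> monomials W" "\<forall>k. k \<notin> S \<longrightarrow> c k = 0"
        "x \<approx>\<^sub>r (\<Sum>k\<in>S. const (c k) * monomial k)" and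
      T: "finite T" "T \<subseteq> monomials W" "\<forall>k. k \<notin> T \<longrightarrow> d k = 0"
        "y \<approx>\<^sub>r (\<Sum>k\<in>T. const (d k) * monomial k)"
      by blast
    have "(\<Sum>k\<in>S. const (c k) * monomial k) = (\<Sum>k\<in>S \<union> T. const (c k) * monomial k)"
      by (rule sum.mono_neutral_left) (use S T in auto)
    moreover have "(\<Sum>k\<in>T. const (d k) * monomial k) = (\<Sum>k\<in>S \<union> T. const (d k) * monomial k)"
      by (rule sum.mono_neutral_left) (use S T in auto)
    ultimately have "x + y \<approx>\<^sub>r (\<Sum>k\<in>S \<union> T. const (c k + d k) * monomial k)"
      using eqv_add[OF S(4) T(4)]
      by (simp add: const_add[symmetric] distrib_right sum.distrib)
    then show ?case
      by (intro exI[of _ "S \<union> T"] exI[of _ "\<lambda>k. c k + d k"]) (use S T in auto)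
  next
    case (mspan_const x j)
    then obtain S c where
      S: "finite S" "S \<subseteq> monomials W" "\<forall>k. k \<notin> S \<longrightarrow> c k = 0"
        "x \<approx>\<^sub>r (\<Sum>k\<in>S. const (c k) * monomial k)"
      by blast
    have "const j * x \<approx>\<^sub>r (\<Sum>k\<in>S. const (j * c k) * monomial k)"
      using eqv_const[OF S(4), of j]
      by (simp add: const_mult[symmetric] sum_distrib_left mult.assoc)
    then show ?case
      by (intro exI[of _ S] exI[of _ "\<lambda>k. j * c k"]) (use S in auto)
  qed
  then show thesis using that by blast
qed

section \<open>Every nonzero ideal contains a vertex\<close>

lemma ghost_path_mspan: "path p \<Longrightarrow> ghost_path p \<in> mspan {last p}"
  by (rule mspan_eqv[OF eqv_sym[OF ghost_path_last]])
     (use mspan_monomial[of "[last p]" p "{last p}"] path_last_Field in auto)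

lemma real_path_mspan: "path p \<Longrightarrow> real_path p \<in> mspan {last p}"
  by (rule mspan_eqv[OF eqv_sym[OF real_path_last]])
     (use mspan_monomial[of p "[last p]" "{last p}"] path_last_Field in auto)

lemma mspan_mult_above:
  assumes "x \<in> mspan {a}" "y \<in> mspan {b. a \<lless> b}"
  shows "x * y \<in> mspan {b. a \<lless> b}" "y * x \<in> mspan {b. a \<lless> b}"
  using assms by (auto elim!: mspan_mult dest: less_asym)

lemma transport_vertex:
  assumes "a \<lless> b"
  shows "ghost a b * vertex a * edge a b \<approx>\<^sub>r vertex b"
proof -
  have "ghost a b * vertex a * edge a b \<approx>\<^sub>r ghost a b * edge a b"
    by (rule eqv_mult_r[OF ghost_vertex_same]) (use assms in auto)
  also have "\<dots> \<approx>\<^sub>r vertex b" using ghost_edge[OF assms assms] by simp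
  finally show ?thesis .
qed

text \<open>
  Let \<open>p q\<^sup>*\<close> be a monomial of \<open>x\<close> with smallest end \<open>a\<close> and coefficient \<open>c \<noteq> 0\<close>. Then
  \<open>p\<^sup>* x q = c a + b\<close>, where all monomials of \<open>b\<close> end beyond \<open>a\<close>. An edge \<open>e\<close> that starts at \<open>a\<close>
  and avoids the finitely many first edges in \<open>b\<close> gives \<open>e\<^sup>* b = 0\<close>, hence
  \<open>e\<^sup>* (p\<^sup>* x q) e\<close> is \<open>c\<close> times the end of \<open>e\<close>.
\<close>

lemma compress_to_vertex_span:
  assumes x: "x \<in> mspan (Field \<kappa>)" "\<not> x \<approx>\<^sub>r 0"
  shows "\<exists>a\<in>Field \<kappa>. \<exists>y\<in>R. \<exists>z\<in>R. y * x * z \<approx>\<^sub>r vertex a"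
proof -
  obtain S0 c where S0: "finite S0" "S0 \<subseteq> monomials (Field \<kappa>)" "\<And>k. k \<notin> S0 \<Longrightarrow> c k = 0"
    "x \<approx>\<^sub>r (\<Sum>k\<in>S0. const (c k) * monomial k)"
    using mspan_combination[OF x(1)] by blast
  define S where "S = {k \<in> S0. c k \<noteq> 0}"
  have S: "finite S" "\<And>k. k \<in> S \<Longrightarrow> k \<in> monomials (Field \<kappa>)" "\<And>k. k \<in> S \<Longrightarrow> c k \<noteq> 0"
    using S0 by (auto simp: S_def)
  have xS: "x \<approx>\<^sub>r (\<Sum>k\<in>S. const (c k) * monomial k)"
  proof -
    have "(\<Sum>k\<in>S0. const (c k) * monomial k) = (\<Sum>k\<in>S. const (c k) * monomial k)"
      by (rule sum.mono_neutral_right) (use S0 in \<open>auto simp: S_def\<close>)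
    then show ?thesis using S0 by simp
  qed
  have "S \<noteq> {}" using xS x(2) by auto
  moreover have "(\<lambda>k. last (snd k)) ` S \<subseteq> Field \<kappa>"
    using S(2) by (auto simp: monomials_def)
  ultimately obtain a where a: "a \<in> (\<lambda>k. last (snd k)) ` S"
    "\<And>b. b \<in> (\<lambda>k. last (snd k)) ` S \<Longrightarrow> b = a \<or> a \<lless> b"
    using exists_minimal[of "(\<lambda>k. last (snd k)) ` S"] by blast
  from a(1) obtain p q where pq: "(p, q) \<in> S" "a = last q" by auto
  have pq': "path p" "path q" "last p = a" "a \<in> Field \<kappa>"
    using S(2)[OF pq(1)] pq(2) by (auto simp: monomials_def)
  define t where "t k = ghost_path p * (const (c k) * monomial k) * real_path q" for k
  have t_alt: "t k = const (c k) * (ghost_path p * real_path (fst k) * (ghost_path (snd k) * real_path q))"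
    for k
    by (simp add: t_def monomial_def mult.assoc const_left_commute[of "ghost_path p"])
  have t_level: "t k \<approx>\<^sub>r (if k = (p, q) then const (c k) * vertex a else 0)"
    if k: "k \<in> S" "last (snd k) = a" for k
  proof -
    have k': "path (fst k)" "path (snd k)" "last (fst k) = a"
      using S(2)[OF k(1)] k(2) by (auto simp: monomials_def)
    have "ghost_path p * real_path (fst k) * (ghost_path (snd k) * real_path q) \<approx>\<^sub>r
        (if p = fst k then vertex a else 0) * (if snd k = q then vertex a else 0)"
      using eqv_mult[OF ghost_path_real_path_same[of p "fst k"] ghost_path_real_path_same[of "snd k" q]]
        pq pq' k k' by auto
    also have "\<dots> \<approx>\<^sub>r (if k = (p, q) then vertex a else 0)"
      using vertex_vertex[of a a] pq' by (cases k) auto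
    finally have "t k \<approx>\<^sub>r const (c k) * (if k = (p, q) then vertex a else 0)"
      unfolding t_alt by (rule eqv_const)
    then show ?thesis by (cases "k = (p, q)") auto
  qed
  have t_rest: "t k \<in> mspan {b. a \<lless> b}" if k: "k \<in> S" "k \<noteq> (p, q)" for k
  proof (cases "last (snd k) = a")
    case True
    then show ?thesis using t_level[OF k(1)] k(2) by (intro mspan_rel) (simp add: eqv_zero_iff)
  next
    case False
    then have "a \<lless> last (snd k)" using a(2)[of "last (snd k)"] k by auto
    then have "const (c k) * monomial k \<in> mspan {b. a \<lless> b}"
      using S(2)[OF k(1)] by (intro mspan_const monomial_mspan) (auto simp: monomials_def)
    then have "ghost_path p * (const (c k) * monomial k) \<in> mspan {b. a \<lless> b}"
      using mspan_mult_above(1)[OF ghost_path_mspan[OF pq'(1)]] pq'(3) by simp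
    then show ?thesis
      unfolding t_def
      using mspan_mult_above(2)[OF real_path_mspan[OF pq'(2)]] pq(2) by simp
  qed
  define b where "b = (\<Sum>k\<in>S - {(p, q)}. t k)"
  have b: "b \<in> mspan {b. a \<lless> b}"
    unfolding b_def by (rule mspan_sum) (use t_rest in auto)
  have "ghost_path p * x * real_path q \<approx>\<^sub>r ghost_path p * (\<Sum>k\<in>S. const (c k) * monomial k) * real_path q"
    by (intro eqv_mult_l eqv_mult_r xS) (use pq' in auto)
  also have "\<dots> = t (p, q) + b"
    by (simp add: t_def b_def sum_distrib_left sum_distrib_right distrib_left distrib_right
        sum.remove[OF S(1) pq(1)])
  also have "\<dots> \<approx>\<^sub>r const (c (p, q)) * vertex a + b"
    using t_level[OF pq(1)] pq(2) mspan_R[OF b] by (intro eqv_add) auto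
  finally have corner: "ghost_path p * x * real_path q \<approx>\<^sub>r const (c (p, q)) * vertex a + b" .
  obtain w where w: "a \<lless> w" "ghost a w * b \<approx>\<^sub>r 0"
    using exists_above[OF pq'(4) finite_edges[OF b]] by blast
  have w_Field: "w \<in> Field \<kappa>" using less_Field w by blast
  have "ghost a w * (ghost_path p * x * real_path q) * edge a w
      \<approx>\<^sub>r ghost a w * (const (c (p, q)) * vertex a + b) * edge a w"
    by (intro eqv_mult_l eqv_mult_r corner) (use w in auto)
  also have "\<dots> = const (c (p, q)) * (ghost a w * vertex a * edge a w) + ghost a w * b * edge a w"
    by (simp add: distrib_left distrib_right mult.assoc const_left_commute[of "ghost a w"])
  also have "\<dots> \<approx>\<^sub>r const (c (p, q)) * vertex w + 0 * edge a w"
    by (intro eqv_add eqv_const transport_vertex eqv_mult_r w) (use w in auto)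
  finally have *: "ghost a w * (ghost_path p * x * real_path q) * edge a w \<approx>\<^sub>r const (c (p, q)) * vertex w"
    by simp
  have "const (inverse (c (p, q))) * (ghost a w * (ghost_path p * x * real_path q) * edge a w)
      \<approx>\<^sub>r const (inverse (c (p, q))) * (const (c (p, q)) * vertex w)"
    by (rule eqv_const[OF *])
  also have "\<dots> = vertex w"
    by (rule const_inverse_mult[OF S(3)[OF pq(1)]])
  finally have "const (inverse (c (p, q))) * ghost a w * ghost_path p * x * (real_path q * edge a w)
      \<approx>\<^sub>r vertex w"
    by (simp add: mult.assoc)
  moreover have "const (inverse (c (p, q))) * ghost a w * ghost_path p \<in> R" "real_path q * edge a w \<in> R"
    using pq' w by auto
  ultimately show ?thesis using w_Field by blast
qed

text \<open>If \<open>x\<close> has a constant term, any vertex that annihilates the rest of \<open>x\<close> will do.\<close>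

lemma compress_to_vertex:
  assumes x: "x \<in> R" "\<not> x \<approx>\<^sub>r 0"
  shows "\<exists>a\<in>Field \<kappa>. \<exists>y\<in>R. \<exists>z\<in>R. y * x * z \<approx>\<^sub>r vertex a"
proof (cases "const_term x = 0")
  case True
  then show ?thesis using compress_to_vertex_span[OF mspan_Field'[OF x(1)] x(2)] by simp
next
  case False
  define k where "k = const_term x"
  define r where "r = x - const k"
  have r: "r \<in> mspan (Field \<kappa>)" "x = const k + r" "k \<noteq> 0"
    using mspan_Field[OF x(1)] False by (auto simp: r_def k_def)
  obtain a0 where "a0 \<in> Field \<kappa>" using Field_nonempty .
  then obtain a where a: "a0 \<lless> a" "a \<notin> {a \<in> Field \<kappa>. \<not> vertex a * r \<approx>\<^sub>r 0}"
    using exists_above[OF _ finite_vertices[OF r(1)]] by blast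
  then have a': "a \<in> Field \<kappa>" "vertex a * r \<approx>\<^sub>r 0" using less_Field by auto
  have "const (inverse k) * vertex a * x * 1 = vertex a + const (inverse k) * (vertex a * r)"
    unfolding r(2)
    by (simp add: distrib_left const_commute[of "vertex a"] const_inverse_mult r(3) mult.assoc)
  also have "\<dots> \<approx>\<^sub>r vertex a + const (inverse k) * 0"
    by (intro eqv_add eqv_const) (use a' in auto)
  finally have "const (inverse k) * vertex a * x * 1 \<approx>\<^sub>r vertex a" by simp
  then show ?thesis using a' by blast
qed

end

section \<open>Von Neumann regularity\<close>

context leavitt_ordinal
begin

text \<open>Von Neumann regularity of the element that a polynomial represents.\<close>

definition regular :: "(('a, 'a \<times> 'a) generator free_monoid \<Rightarrow>\<^sub>0 'k) \<Rightarrow> bool" where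
  "regular x \<longleftrightarrow> (\<exists>y\<in>R. x \<approx>\<^sub>r x * y * x)"

lemma regular_eqv:
  assumes "x \<approx>\<^sub>r x'" "regular x'"
  shows "regular x"
proof -
  obtain y where y: "y \<in> R" "x' \<approx>\<^sub>r x' * y * x'"
    using assms(2) by (auto simp: regular_def)
  have "x \<approx>\<^sub>r x' * y * x'" using assms(1) y(2) by (rule eqv_trans)
  also have "\<dots> \<approx>\<^sub>r x * y * x"
    by (intro eqv_mult eqv_sym[OF assms(1)]) (use y in auto)
  finally show ?thesis using y(1) by (auto simp: regular_def)
qed

text \<open>McCoy's lemma: regularity of the defect \<open>x - x y x\<close> suffices.\<close>

lemma regular_defect:
  assumes "x \<in> R" "y \<in> R" "regular (x - x * y * x)"
  shows "regular x"
proof -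
  obtain z where z: "z \<in> R" "x - x * y * x \<approx>\<^sub>r (x - x * y * x) * z * (x - x * y * x)"
    using assms(3) by (auto simp: regular_def)
  have "x = (x - x * y * x) + x * y * x" by simp
  also have "\<dots> \<approx>\<^sub>r (x - x * y * x) * z * (x - x * y * x) + x * y * x"
    by (rule eqv_add[OF z(2)]) (use assms in auto)
  also have "\<dots> = x * (z - z * x * y - y * x * z + y * x * z * x * y + y) * x"
    by (simp add: algebra_simps)
  finally show ?thesis
    using assms(1,2) z(1) by (auto simp: regular_def)
qed

context
  fixes u :: 'a and S T :: "'a list set" and f :: "'a list \<Rightarrow> 'a list \<Rightarrow> 'k"
  assumes S: "finite S" "\<And>p. p \<in> S \<Longrightarrow> path p \<and> last p = u"
    and T: "finite T" "\<And>p. p \<in> T \<Longrightarrow> path p \<and> last p = u"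
begin

text \<open>Multiplying a combination of matrix units by \<open>q\<close> from the right extracts column \<open>q\<close>.\<close>

lemma combination_column:
  assumes q: "q \<in> T"
  shows "(\<Sum>r\<in>S. \<Sum>s\<in>T. const (f r s) * (real_path r * ghost_path s)) * real_path q
    \<approx>\<^sub>r (\<Sum>r\<in>S. const (f r q) * real_path r)"
proof -
  have "(\<Sum>r\<in>S. \<Sum>s\<in>T. const (f r s) * (real_path r * ghost_path s)) * real_path q
      = (\<Sum>r\<in>S. \<Sum>s\<in>T. const (f r s) * (real_path r * (ghost_path s * real_path q)))"
    by (simp add: sum_distrib_right mult.assoc)
  also have "\<dots> \<approx>\<^sub>r (\<Sum>r\<in>S. \<Sum>s\<in>T. const (f r s) * (real_path r * (if s = q then vertex u else 0)))"
  proof (intro eqv_sum eqv_const eqv_mult_l)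
    fix r s assume "r \<in> S" "s \<in> T"
    then show "ghost_path s * real_path q \<approx>\<^sub>r (if s = q then vertex u else 0)" "real_path r \<in> R"
      using ghost_path_real_path_same[of s q] T(2)[of s] T(2)[OF q] S(2)[of r]
      by (auto split: if_splits)
  qed
  also have "\<dots> = (\<Sum>r\<in>S. const (f r q) * (real_path r * vertex u))"
    using T(1) q by (simp add: if_distrib cong: if_cong)
  also have "\<dots> \<approx>\<^sub>r (\<Sum>r\<in>S. const (f r q) * real_path r)"
    using S real_path_last by (intro eqv_sum eqv_const) auto
  finally show ?thesis .
qed

lemma combination_row:
  assumes p: "p \<in> S"
  shows "ghost_path p * (\<Sum>r\<in>S. \<Sum>s\<in>T. const (f r s) * (real_path r * ghost_path s))
    \<approx>\<^sub>r (\<Sum>s\<in>T. const (f p s) * ghost_path s)"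
proof -
  have "ghost_path p * (\<Sum>r\<in>S. \<Sum>s\<in>T. const (f r s) * (real_path r * ghost_path s))
      = (\<Sum>s\<in>T. \<Sum>r\<in>S. const (f r s) * (ghost_path p * real_path r * ghost_path s))"
    by (subst sum.swap)
       (simp add: sum_distrib_left mult.assoc const_left_commute[of "ghost_path p"])
  also have "\<dots> \<approx>\<^sub>r (\<Sum>s\<in>T. \<Sum>r\<in>S. const (f r s) * ((if p = r then vertex u else 0) * ghost_path s))"
  proof (intro eqv_sum eqv_const eqv_mult_r)
    fix r s assume "r \<in> S" "s \<in> T"
    then show "ghost_path p * real_path r \<approx>\<^sub>r (if p = r then vertex u else 0)" "ghost_path s \<in> R"
      using ghost_path_real_path_same[of p r] T(2)[of s] S(2)[OF p] S(2)[of r]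
      by (auto split: if_splits)
  qed
  also have "\<dots> = (\<Sum>s\<in>T. const (f p s) * (vertex u * ghost_path s))"
    using S(1) p by (simp add: if_distrib if_distribR cong: if_cong)
  also have "\<dots> \<approx>\<^sub>r (\<Sum>s\<in>T. const (f p s) * ghost_path s)"
    using T ghost_path_last by (intro eqv_sum eqv_const) auto
  finally show ?thesis .
qed

text \<open>
  Subtracting \<open>A y A\<close> for \<open>y = c q p\<^sup>*\<close> changes the coefficients by a matrix of rank one. If \<open>c\<close> is the
  inverse of the coefficient at \<open>(p, q)\<close>, this is Gauss elimination with that pivot: column \<open>q\<close>
  becomes zero.
\<close>

lemma combination_pivot:
  assumes p: "p \<in> S" and q: "q \<in> T"
  defines "A \<equiv> (\<Sum>r\<in>S. \<Sum>s\<in>T. const (f r s) * (real_path r * ghost_path s))"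
  shows "A - A * (const c * (real_path q * ghost_path p)) * A
    \<approx>\<^sub>r (\<Sum>r\<in>S. \<Sum>s\<in>T. const (f r s - c * f r q * f p s) * (real_path r * ghost_path s))"
proof -
  have A: "A \<in> R" unfolding A_def using S T by auto
  have "A * (const c * (real_path q * ghost_path p)) * A
      = const c * ((A * real_path q) * (ghost_path p * A))"
    by (simp add: mult.assoc const_left_commute[of A])
  also have "\<dots> \<approx>\<^sub>r const c * ((\<Sum>r\<in>S. const (f r q) * real_path r) * (\<Sum>s\<in>T. const (f p s) * ghost_path s))"
    unfolding A_def by (intro eqv_const eqv_mult combination_column combination_row p q)
  also have "\<dots> = (\<Sum>r\<in>S. \<Sum>s\<in>T. const (c * f r q * f p s) * (real_path r * ghost_path s))"
  proof -
    have "const c * (const (f r q) * real_path r * (const (f p s) * ghost_path s))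
        = const (c * f r q * f p s) * (real_path r * ghost_path s)" for r s
      by (simp only: const_mult[symmetric] mult.assoc const_left_commute[of "real_path r"])
    then show ?thesis by (subst sum_product) (simp only: sum_distrib_left)
  qed
  finally have "A - A * (const c * (real_path q * ghost_path p)) * A
      \<approx>\<^sub>r A - (\<Sum>r\<in>S. \<Sum>s\<in>T. const (c * f r q * f p s) * (real_path r * ghost_path s))"
    by (intro eqv_diff) (use A in auto)
  also have "\<dots> = (\<Sum>r\<in>S. \<Sum>s\<in>T. const (f r s - c * f r q * f p s) * (real_path r * ghost_path s))"
    by (simp add: A_def sum_subtractf[symmetric] single_diff left_diff_distrib)
  finally show ?thesis .
qed

end

text \<open>
  Induction step: the part of an element that lives on the lowest level \<open>u\<close> is removed column by
  column, at the cost of changing the part that lives on the higher levels.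
\<close>

lemma regular_level:
  assumes T: "finite T" "\<And>p. p \<in> T \<Longrightarrow> path p \<and> last p = u"
    and S: "finite S" "\<And>p. p \<in> S \<Longrightarrow> path p \<and> last p = u"
    and W: "\<And>w. w \<in> W \<Longrightarrow> u \<lless> w" "\<And>x. x \<in> mspan W \<Longrightarrow> regular x" "W \<subseteq> Field \<kappa>"
    and b: "b \<in> mspan W"
  shows "regular ((\<Sum>r\<in>S. \<Sum>s\<in>T. const (f r s) * (real_path r * ghost_path s)) + b)"
  using T b
proof (induction T arbitrary: f b rule: finite_induct)
  case empty
  then show ?case using W(2) by simp
next
  case (insert q T)
  let ?comb = "\<lambda>f T. \<Sum>r\<in>S. \<Sum>s\<in>T. const (f r s) * (real_path r * ghost_path s)"
  have drop: "?comb g (insert q T) = ?comb g T" if "\<And>r. r \<in> S \<Longrightarrow> g r q = 0" for g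
    by (rule sum.cong[OF refl]) (use insert.hyps that in simp)
  show ?case
  proof (cases "\<forall>r\<in>S. f r q = 0")
    case True
    then show ?thesis using drop[of f] insert by simp
  next
    case False
    then obtain p where p: "p \<in> S" "f p q \<noteq> 0" by auto
    define c where "c = inverse (f p q)"
    define A where "A = ?comb f (insert q T)"
    define y where "y = const c * (real_path q * ghost_path p)"
    define g where "g r s = f r s - c * f r q * f p s" for r s
    have paths: "path p" "last p = u" "path q" "last q = u" using p S insert.prems by auto
    have u: "u \<in> Field \<kappa>" using path_last_Field[OF paths(1)] paths by simp
    have A: "A \<in> mspan {u}" unfolding A_def
      using S insert.prems by (intro mspan_sum mspan_const mspan_monomial) auto
    have y: "y \<in> mspan {u}" unfolding y_def
      using paths by (intro mspan_const mspan_monomial) auto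
    note b = insert.prems(2)
    have low: "x * z \<in> mspan W" "z * x \<in> mspan W" if "x \<in> mspan {u}" "z \<in> mspan W" for x z
      using that by (auto elim!: mspan_mult dest: W(1) less_asym)
    have high: "x * z \<in> mspan W" if "x \<in> mspan W" "z \<in> mspan W" for x z
      using that
      by (rule mspan_mult) (metis W(3) less_linear subsetD)
    have b': "b - (A * y * b + b * y * A + b * y * b) \<in> mspan W" (is "?b' \<in> _")
    proof -
      have "A * (y * b) \<in> mspan W" "b * y * A \<in> mspan W" "b * y * b \<in> mspan W"
        using low(1)[OF A low(1)[OF y b]] low(2)[OF A low(2)[OF y b]] high[OF low(2)[OF y b] b] .
      then show ?thesis by (intro mspan_diff mspan_add b) (simp_all add: mult.assoc)
    qed
    have "A - A * y * A \<approx>\<^sub>r ?comb g (insert q T)"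
      unfolding A_def y_def g_def
      by (rule combination_pivot[where u = u]) (use S insert p in auto)
    also have "\<dots> = ?comb g T"
      using p(2) by (intro drop) (simp add: g_def c_def)
    finally have "(A - A * y * A) + ?b' \<approx>\<^sub>r ?comb g T + ?b'"
      using mspan_R[OF b'] by (intro eqv_add) auto
    moreover have "(A + b) - (A + b) * y * (A + b) = (A - A * y * A) + ?b'"
      by (simp add: algebra_simps)
    ultimately have "(A + b) - (A + b) * y * (A + b) \<approx>\<^sub>r ?comb g T + ?b'"
      by (simp only:)
    moreover have "regular (?comb g T + ?b')"
      using insert.prems(1) b' by (intro insert.IH) auto
    ultimately have "regular ((A + b) - (A + b) * y * (A + b))"
      by (rule regular_eqv)
    moreover have "A + b \<in> R" "y \<in> R"
      using mspan_R[OF A] mspan_R[OF b] mspan_R[OF y] by auto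
    ultimately have "regular (A + b)"
      using regular_defect by blast
    then show ?thesis by (simp only: A_def)
  qed
qed


text \<open>Induction on the number of levels; the lowest one is cleared first.\<close>

lemma regular_finite_levels:
  assumes "finite W" "W \<subseteq> Field \<kappa>" "x \<in> mspan W"
  shows "regular x"
  using assms
proof (induction W arbitrary: x rule: finite_psubset_induct)
  case (psubset W)
  obtain S c where S: "finite S" "S \<subseteq> monomials W" "\<And>k. k \<notin> S \<Longrightarrow> c k = 0"
    "x \<approx>\<^sub>r (\<Sum>k\<in>S. const (c k) * monomial k)"
    using mspan_combination[OF psubset.prems(2)] by blast
  show ?case
  proof (cases "W = {}")
    case True
    then have "S = {}" using S(2) by (auto simp: monomials_def)
    then have "x \<approx>\<^sub>r 0" using S(4) by simp
    moreover have "regular 0" by (auto simp: regular_def)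
    ultimately show ?thesis by (rule regular_eqv)
  next
    case False
    then obtain u where u: "u \<in> W" "\<And>w. w \<in> W \<Longrightarrow> w = u \<or> u \<lless> w"
      using exists_minimal[OF psubset.prems(1)] by blast
    define V where "V = W - {u}"
    define L where "L = {k \<in> S. last (snd k) = u}"
    have L: "finite L" "L \<subseteq> S" using S(1) by (auto simp: L_def)
    define b where "b = (\<Sum>k\<in>S - L. const (c k) * monomial k)"
    have b: "b \<in> mspan V" unfolding b_def
    proof (intro mspan_sum mspan_const monomial_mspan)
      fix k assume "k \<in> S - L"
      then show "k \<in> monomials V" using S(2) by (auto simp: monomials_def L_def V_def)
    qed
    define f where "f r s = (if (r, s) \<in> L then c (r, s) else 0)" for r s
    have "(\<Sum>k\<in>L. const (c k) * monomial k)
        = (\<Sum>k\<in>fst ` L \<times> snd ` L. const (f (fst k) (snd k)) * monomial k)"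
      by (rule sum.mono_neutral_cong_left) (use L(1) in \<open>auto simp: f_def image_iff\<close>, force+)
    also have "\<dots> = (\<Sum>r\<in>fst ` L. \<Sum>s\<in>snd ` L. const (f r s) * (real_path r * ghost_path s))"
      by (simp add: sum.cartesian_product monomial_def case_prod_unfold)
    finally have "x \<approx>\<^sub>r (\<Sum>r\<in>fst ` L. \<Sum>s\<in>snd ` L. const (f r s) * (real_path r * ghost_path s)) + b"
      using S(4) sum.subset_diff[OF L(2) S(1), of "\<lambda>k. const (c k) * monomial k"]
      by (simp add: b_def add.commute)
    moreover have "regular ((\<Sum>r\<in>fst ` L. \<Sum>s\<in>snd ` L. const (f r s) * (real_path r * ghost_path s)) + b)"
    proof (rule regular_level[where u = u and W = V])
      show "path p \<and> last p = u" if "p \<in> fst ` L" for p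
        using that S(2) by (force simp: L_def monomials_def)
      show "path p \<and> last p = u" if "p \<in> snd ` L" for p
        using that S(2) by (force simp: L_def monomials_def)
      show "regular z" if "z \<in> mspan V" for z
        using that psubset.IH[of V] u(1) psubset.prems(1) by (auto simp: V_def)
    qed (use L b u psubset.prems in \<open>auto simp: V_def\<close>)
    ultimately show ?thesis by (rule regular_eqv)
  qed
qed

lemma regular_span:
  assumes "x \<in> mspan (Field \<kappa>)"
  shows "regular x"
proof -
  obtain S c where S: "finite S" "S \<subseteq> monomials (Field \<kappa>)" "\<And>k. k \<notin> S \<Longrightarrow> c k = 0"
    "x \<approx>\<^sub>r (\<Sum>k\<in>S. const (c k) * monomial k)"
    using mspan_combination[OF assms] by blast
  let ?W = "(\<lambda>k. last (snd k)) ` S"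
  have "k \<in> monomials ?W" if "k \<in> S" for k
    using S(2) that imageI[OF that, of "\<lambda>k. last (snd k)"] by (cases k) (auto simp: monomials_def)
  then have "(\<Sum>k\<in>S. const (c k) * monomial k) \<in> mspan ?W"
    by (intro mspan_sum mspan_const monomial_mspan)
  then have "regular (\<Sum>k\<in>S. const (c k) * monomial k)"
    using S by (intro regular_finite_levels[of ?W]) (auto simp: monomials_def)
  then show ?thesis by (rule regular_eqv[OF S(4)])
qed

lemma regular_all:
  assumes x: "x \<in> R"
  shows "regular x"
proof (cases "const_term x = 0")
  case True
  then show ?thesis using regular_span[OF mspan_Field'[OF x]] by simp
next
  case False
  \<comment> \<open>The defect for the inverse of the constant term has no constant term.\<close>
  let ?y = "const (inverse (const_term x))"
  have "x - x * ?y * x \<in> R" using x by auto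
  moreover have "const_term (x - x * ?y * x) = 0"
    using False by (simp add: lookup_minus const_term_mult)
  ultimately have "regular (x - x * ?y * x)"
    using regular_span mspan_Field' by blast
  then show ?thesis using x regular_defect[of x ?y] by blast
qed

lemma von_neumann_regular_U: "von_neumann_regular U"
  unfolding von_neumann_regular_def
proof
  fix a assume "a \<in> carrier U"
  then obtain x where x: "x \<in> R" "a = proj x" by (rule proj_surj)
  then obtain y where "y \<in> R" "x \<approx>\<^sub>r x * y * x"
    using regular_all by (auto simp: regular_def)
  then show "\<exists>y\<in>carrier U. a = a \<otimes>\<^bsub>U\<^esub> y \<otimes>\<^bsub>U\<^esub> a"
    using x by (intro bexI[of _ "proj y"]) (simp_all add: proj_mult proj_eq_iff proj_closed)
qed

section \<open>Primeness\<close>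

interpretation U: ring U
  using unital_algebra_U by (rule unital_algebra.axioms(1))

lemma vertex_U_nonzero: "a \<in> Field \<kappa> \<Longrightarrow> proj (vertex a) \<noteq> \<zero>\<^bsub>U\<^esub>"
  using vertex_nonzero by (simp add: proj_zero proj_eq_iff)

text \<open>An ideal that contains the vertex \<open>a\<close> contains each larger vertex \<open>b\<close>, as \<open>b = e\<^sup>* a e\<close> for the edge
  \<open>e\<close> from \<open>a\<close> to \<open>b\<close>. Consequently any two nonzero ideals share a vertex.\<close>

lemma ideal_contains_vertices_above:
  assumes "ideal I U" "I \<noteq> {\<zero>\<^bsub>U\<^esub>}"
  obtains a where "a \<in> Field \<kappa>" "\<And>b. b = a \<or> a \<lless> b \<Longrightarrow> proj (vertex b) \<in> I"
proof -
  interpret I: ideal I U by fact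
  obtain z where z: "z \<in> I" "z \<noteq> \<zero>\<^bsub>U\<^esub>"
    using assms(2) I.zero_closed by auto
  then obtain x where x: "x \<in> R" "z = proj x"
    using I.Icarr proj_surj by blast
  then have "\<not> x \<approx>\<^sub>r 0" using z by (simp add: proj_zero proj_eq_iff)
  then obtain a y w where a: "a \<in> Field \<kappa>" "y \<in> R" "w \<in> R" "y * x * w \<approx>\<^sub>r vertex a"
    using compress_to_vertex[OF x(1)] by blast
  have "proj y \<otimes>\<^bsub>U\<^esub> z \<otimes>\<^bsub>U\<^esub> proj w \<in> I"
    using z a by (intro I.I_r_closed I.I_l_closed) (auto simp: proj_closed)
  also have "proj y \<otimes>\<^bsub>U\<^esub> z \<otimes>\<^bsub>U\<^esub> proj w = proj (vertex a)"
    using a x by (simp add: proj_mult proj_eq_iff)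
  finally have va: "proj (vertex a) \<in> I" .
  show thesis
  proof (rule that[OF a(1)])
    fix b assume "b = a \<or> a \<lless> b"
    then show "proj (vertex b) \<in> I"
    proof
      assume ab: "a \<lless> b"
      have "proj (ghost a b) \<otimes>\<^bsub>U\<^esub> proj (vertex a) \<otimes>\<^bsub>U\<^esub> proj (edge a b) \<in> I"
        using va ab by (intro I.I_r_closed I.I_l_closed) (auto simp: proj_closed)
      also have "proj (ghost a b) \<otimes>\<^bsub>U\<^esub> proj (vertex a) \<otimes>\<^bsub>U\<^esub> proj (edge a b) = proj (vertex b)"
        using transport_vertex[OF ab] a(1) ab less_Field[OF ab] by (simp add: proj_mult proj_eq_iff)
      finally show ?thesis .
    qed (use va in simp)
  qed
qed

lemma prime_U: "prime_ring U"
  unfolding prime_ring_def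
proof (intro allI impI, elim conjE)
  fix I J assume IJ: "ideal I U" "ideal J U" "I \<noteq> {\<zero>\<^bsub>U\<^esub>}" "J \<noteq> {\<zero>\<^bsub>U\<^esub>}"
  obtain a where a: "a \<in> Field \<kappa>" "\<And>c. c = a \<or> a \<lless> c \<Longrightarrow> proj (vertex c) \<in> I"
    using ideal_contains_vertices_above[OF IJ(1,3)] by blast
  obtain b where b: "b \<in> Field \<kappa>" "\<And>c. c = b \<or> b \<lless> c \<Longrightarrow> proj (vertex c) \<in> J"
    using ideal_contains_vertices_above[OF IJ(2,4)] by blast
  obtain c where c: "c \<in> Field \<kappa>" "c = a \<or> a \<lless> c" "c = b \<or> b \<lless> c"
    using less_linear[OF a(1) b(1)] a(1) b(1) by blast
  have "proj (vertex c) \<otimes>\<^bsub>U\<^esub> proj (vertex c) \<in> I \<cdot>\<^bsub>U\<^esub> J"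
    using a(2)[OF c(2)] b(2)[OF c(3)] by (rule ideal_prod.prod)
  moreover have "proj (vertex c) \<otimes>\<^bsub>U\<^esub> proj (vertex c) = proj (vertex c)"
    using vertex_vertex[of c c] c(1) by (simp add: proj_mult proj_eq_iff)
  ultimately show "I \<cdot>\<^bsub>U\<^esub> J \<noteq> {\<zero>\<^bsub>U\<^esub>}"
    using vertex_U_nonzero[OF c(1)] by auto
qed

end

section \<open>Nonprimitivity\<close>

context leavitt_ordinal
begin

text \<open>The monomials that end beyond \<open>u\<close> span a two-sided ideal, also in the unitization.\<close>

lemma mspan_above_ideal:
  assumes x: "x \<in> R" and y: "y \<in> mspan {w. u \<lless> w}"
  shows "x * y \<in> mspan {w. u \<lless> w}" "y * x \<in> mspan {w. u \<lless> w}"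
proof -
  define c r where "c = const_term x" and "r = x - const c"
  have x_eq: "x = const c + r" and r: "r \<in> mspan (Field \<kappa>)"
    using mspan_Field[OF x] by (auto simp: c_def r_def)
  have aux: "(\<not> w \<lless> v \<longrightarrow> w \<in> {w. u \<lless> w}) \<and> (\<not> v \<lless> w \<longrightarrow> v \<in> {w. u \<lless> w})"
    if "v \<in> Field \<kappa>" "w \<in> {w. u \<lless> w}" for v w
    using that less_linear[of v w] less_Field(2)[of u w] less_trans[of u w v] by auto
  have "r * y \<in> mspan {w. u \<lless> w}"
    by (rule mspan_mult[OF r y]) (rule aux)
  moreover have "y * r \<in> mspan {w. u \<lless> w}"
    by (rule mspan_mult[OF y r]) (use aux in blast)
  ultimately show "x * y \<in> mspan {w. u \<lless> w}" "y * x \<in> mspan {w. u \<lless> w}"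
    unfolding x_eq
    by (auto simp: distrib_left distrib_right const_commute[of y] intro: mspan_add mspan_const[OF y])
qed

lemma path_snoc: "path (p @ [b]) \<Longrightarrow> p \<noteq> [] \<Longrightarrow> path p \<and> last p \<lless> b"
  by (induction p rule: path.induct) (auto simp: less_Field)

lemma ghost_path_snoc:
  assumes "path p" "last p \<lless> b"
  shows "ghost_path (p @ [b]) \<approx>\<^sub>r ghost (last p) b * ghost_path p"
proof -
  have "ghost_path (p @ [b]) \<approx>\<^sub>r ghost_path [last p, b] * ghost_path p"
    by (rule eqv_sym) (use ghost_path_append[of p "[last p, b]"] assms less_Field in auto)
  also have "ghost_path [last p, b] * ghost_path p \<approx>\<^sub>r ghost (last p) b * ghost_path p"
    using vertex_ghost_same[OF assms(2)] assms by (intro eqv_mult_r) auto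
  finally show ?thesis .
qed

context
  fixes M :: "('k \<times> (('a, 'a \<times> 'a) generator free_monoid \<Rightarrow>\<^sub>0 'k) set, 'm) module"
  assumes simple: "simple_left_module U M" and faithful: "faithful_left_module U M"
begin

interpretation M: left_module U M
  using simple by (simp add: simple_left_module_def)

text \<open>The action of polynomials on the module through the canonical surjection.\<close>

definition scale :: "(('a, 'a \<times> 'a) generator free_monoid \<Rightarrow>\<^sub>0 'k) \<Rightarrow> 'm \<Rightarrow> 'm" where
  "scale x m = proj x \<odot>\<^bsub>M\<^esub> m"

lemma scale_closed [simp]: "x \<in> R \<Longrightarrow> m \<in> carrier M \<Longrightarrow> scale x m \<in> carrier M"
  by (simp add: scale_def M.smult_closed proj_closed)

lemma scale_add:
  "x \<in> R \<Longrightarrow> y \<in> R \<Longrightarrow> m \<in> carrier M \<Longrightarrow> scale (x + y) m = scale x m \<oplus>\<^bsub>M\<^esub> scale y m"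
  by (simp add: scale_def M.smult_l_distr[symmetric] proj_closed proj_add)

lemma scale_distrib: "x \<in> R \<Longrightarrow> m \<in> carrier M \<Longrightarrow> n \<in> carrier M \<Longrightarrow>
    scale x (m \<oplus>\<^bsub>M\<^esub> n) = scale x m \<oplus>\<^bsub>M\<^esub> scale x n"
  by (simp add: scale_def M.smult_r_distr proj_closed)

lemma scale_mult:
  "x \<in> R \<Longrightarrow> y \<in> R \<Longrightarrow> m \<in> carrier M \<Longrightarrow> scale (x * y) m = scale x (scale y m)"
  by (simp add: scale_def M.smult_assoc[symmetric] proj_closed proj_mult)

lemma scale_eqv: "x \<approx>\<^sub>r y \<Longrightarrow> scale x m = scale y m"
  using proj_eq_iff[of x y] eqv_polys[of x y] by (simp add: scale_def)

lemma scale_zero_right [simp]: "x \<in> R \<Longrightarrow> scale x \<zero>\<^bsub>M\<^esub> = \<zero>\<^bsub>M\<^esub>"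
  using scale_distrib[of x "\<zero>\<^bsub>M\<^esub>" "\<zero>\<^bsub>M\<^esub>"] M.add.l_cancel_one by fastforce

lemma scale_zero_left [simp]: "m \<in> carrier M \<Longrightarrow> scale 0 m = \<zero>\<^bsub>M\<^esub>"
  using scale_add[of 0 0 m] M.add.l_cancel_one scale_closed[of 0 m] by fastforce

lemma scale_uminus:
  assumes "x \<in> R" "m \<in> carrier M"
  shows "scale (- x) m = \<ominus>\<^bsub>M\<^esub> scale x m"
  using scale_add[of "- x" x m] assms by (intro M.minus_equality[symmetric]) auto

lemma submoduleI:
  assumes "N \<subseteq> carrier M" "N \<noteq> {}"
    and "\<And>m n. m \<in> N \<Longrightarrow> n \<in> N \<Longrightarrow> m \<oplus>\<^bsub>M\<^esub> n \<in> N"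
    and "\<And>m. m \<in> N \<Longrightarrow> \<ominus>\<^bsub>M\<^esub> m \<in> N"
    and "\<And>x m. x \<in> R \<Longrightarrow> m \<in> N \<Longrightarrow> scale x m \<in> N"
  shows "N = {\<zero>\<^bsub>M\<^esub>} \<or> N = carrier M"
proof -
  have "subgroup N (add_monoid M)"
    by (rule M.add.subgroupI) (use assms in \<open>auto simp: a_inv_def\<close>)
  moreover have "a \<odot>\<^bsub>M\<^esub> m \<in> N" if "a \<in> carrier U" "m \<in> N" for a m
    using proj_surj[OF that(1)] assms(5)[OF _ that(2)] by (auto simp: scale_def)
  ultimately have "submodule N U M"
    by (intro submodule.intro submodule_axioms.intro)
  then show ?thesis using simple by (simp add: simple_left_module_def)
qed

text \<open>
  A nonzero ideal \<open>I\<close> satisfies \<open>I m = M\<close> for every nonzero \<open>m\<close>. It is used for the ideals spanned by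
  the monomials that end beyond \<open>u\<close>.
\<close>

lemma fixing_element:
  assumes u: "u \<in> Field \<kappa>" and m: "m \<in> carrier M" "m \<noteq> \<zero>\<^bsub>M\<^esub>"
  obtains y where "y \<in> mspan {w. u \<lless> w}" "scale y m = m"
proof -
  let ?I = "mspan {w. u \<lless> w}"
  note ideal = mspan_above_ideal[of _ _ u]
  have "(\<lambda>y. scale y m) ` ?I = {\<zero>\<^bsub>M\<^esub>} \<or> (\<lambda>y. scale y m) ` ?I = carrier M"
  proof (rule submoduleI)
    fix n n' assume "n \<in> (\<lambda>y. scale y m) ` ?I" "n' \<in> (\<lambda>y. scale y m) ` ?I"
    then show "n \<oplus>\<^bsub>M\<^esub> n' \<in> (\<lambda>y. scale y m) ` ?I"
      using m by (auto simp: scale_add[symmetric] mspan_R mspan_add)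
  next
    fix n assume "n \<in> (\<lambda>y. scale y m) ` ?I"
    then show "\<ominus>\<^bsub>M\<^esub> n \<in> (\<lambda>y. scale y m) ` ?I"
      using m by (auto simp: scale_uminus[symmetric] mspan_R mspan_uminus)
  next
    fix x n assume "x \<in> R" "n \<in> (\<lambda>y. scale y m) ` ?I"
    then show "scale x n \<in> (\<lambda>y. scale y m) ` ?I"
      using m ideal(1) by (auto simp: scale_mult[symmetric] mspan_R)
  next
    show "(\<lambda>y. scale y m) ` ?I \<subseteq> carrier M" using m mspan_R by auto
    show "(\<lambda>y. scale y m) ` ?I \<noteq> {}" using mspan_zero by blast
  qed
  moreover have "(\<lambda>y. scale y m) ` ?I \<noteq> {\<zero>\<^bsub>M\<^esub>}"
  proof
    assume eq: "(\<lambda>y. scale y m) ` ?I = {\<zero>\<^bsub>M\<^esub>}"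
    define N where "N = {n \<in> carrier M. \<forall>y\<in>?I. scale y n = \<zero>\<^bsub>M\<^esub>}"
    have "N = {\<zero>\<^bsub>M\<^esub>} \<or> N = carrier M"
    proof (rule submoduleI)
      show "N \<noteq> {}" "N \<subseteq> carrier M" using m eq by (auto simp: N_def)
    next
      fix n n' assume "n \<in> N" "n' \<in> N"
      then show "n \<oplus>\<^bsub>M\<^esub> n' \<in> N" by (auto simp: N_def scale_distrib mspan_R)
    next
      fix n assume n: "n \<in> N"
      have "scale y (\<ominus>\<^bsub>M\<^esub> n) = \<zero>\<^bsub>M\<^esub>" if y: "y \<in> ?I" for y
      proof -
        have "scale y (n \<oplus>\<^bsub>M\<^esub> \<ominus>\<^bsub>M\<^esub> n) = scale y n \<oplus>\<^bsub>M\<^esub> scale y (\<ominus>\<^bsub>M\<^esub> n)"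
          using n y by (simp add: N_def mspan_R scale_distrib)
        then show ?thesis using n y by (simp add: N_def mspan_R M.r_neg)
      qed
      then show "\<ominus>\<^bsub>M\<^esub> n \<in> N" using n by (auto simp: N_def)
    next
      fix x n assume "x \<in> R" "n \<in> N"
      then show "scale x n \<in> N"
        using ideal(2) by (auto simp: N_def scale_mult[symmetric] mspan_R)
    qed
    moreover have "m \<in> N" using m(1) eq by (auto simp: N_def)
    ultimately have N: "N = carrier M" using m(2) by auto
    obtain w where w: "u \<lless> w" using exists_above[OF u, of "{}"] by auto
    have "vertex w \<approx>\<^sub>r real_path [w] * ghost_path [w]"
      by (rule eqv_sym) (use vertex_vertex[of w w] less_Field[OF w] in simp)
    then have "vertex w \<in> ?I"
      by (rule mspan_eqv) (rule mspan_monomial, use w less_Field[OF w] in auto)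
    then have "\<forall>n\<in>carrier M. proj (vertex w) \<odot>\<^bsub>M\<^esub> n = \<zero>\<^bsub>M\<^esub>"
      using N by (auto simp: N_def scale_def)
    then have "proj (vertex w) = \<zero>\<^bsub>U\<^esub>"
      using faithful less_Field[OF w] by (simp add: faithful_left_module_def proj_closed)
    then show False using vertex_U_nonzero less_Field[OF w] by blast
  qed
  ultimately have "m \<in> (\<lambda>y. scale y m) ` ?I" using m(1) by auto
  then show thesis using that by force
qed

context
  fixes m0 :: 'm
  assumes m0: "m0 \<in> carrier M" "m0 \<noteq> \<zero>\<^bsub>M\<^esub>"
begin

text \<open>
  The paths whose ghost path does not annihilate \<open>m0\<close> form a finitely branching forest with
  finitely many roots.
\<close>

definition forest :: "nat \<Rightarrow> 'a list set" where
  "forest n = {q. path q \<and> length q = Suc n \<and> scale (ghost_path q) m0 \<noteq> \<zero>\<^bsub>M\<^esub>}"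

lemma finite_branching:
  assumes m: "m \<in> carrier M" "m \<noteq> \<zero>\<^bsub>M\<^esub>"
  shows "finite {b. u \<lless> b \<and> scale (ghost u b) m \<noteq> \<zero>\<^bsub>M\<^esub>}"
proof (cases "u \<in> Field \<kappa>")
  case True
  then obtain y where y: "y \<in> mspan {w. u \<lless> w}" "scale y m = m"
    using fixing_element[OF _ m] by blast
  have "\<not> ghost u b * y \<approx>\<^sub>r 0" if b: "u \<lless> b" "scale (ghost u b) m \<noteq> \<zero>\<^bsub>M\<^esub>" for b
  proof
    assume "ghost u b * y \<approx>\<^sub>r 0"
    then have "scale (ghost u b * y) m = \<zero>\<^bsub>M\<^esub>" using scale_eqv m by force
    then show False using b y m by (simp add: scale_mult mspan_R)
  qed
  then show ?thesis
    by (intro finite_subset[OF _ finite_edges[OF y(1)]]) auto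
next
  case False
  then show ?thesis using less_Field by (auto intro: finite_subset[of _ "{}"])
qed

lemma finite_forest: "finite (forest n)"
proof (induction n)
  case 0
  obtain u where "u \<in> Field \<kappa>" using Field_nonempty .
  then obtain y where y: "y \<in> mspan {w. u \<lless> w}" "scale y m0 = m0"
    using fixing_element[OF _ m0] by blast
  have "\<not> vertex a * y \<approx>\<^sub>r 0" if a: "a \<in> Field \<kappa>" "scale (vertex a) m0 \<noteq> \<zero>\<^bsub>M\<^esub>" for a
  proof
    assume "vertex a * y \<approx>\<^sub>r 0"
    then have "scale (vertex a * y) m0 = \<zero>\<^bsub>M\<^esub>" using scale_eqv m0 by force
    then show False using a y m0 by (simp add: scale_mult mspan_R)
  qed
  then have "forest 0 \<subseteq> (\<lambda>a. [a]) ` {a \<in> Field \<kappa>. \<not> vertex a * y \<approx>\<^sub>r 0}"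
    by (auto simp: forest_def length_Suc_conv)
  then show ?case using finite_vertices[OF y(1)] finite_surj by blast
next
  case (Suc n)
  have "forest (Suc n) \<subseteq> (\<Union>p\<in>forest n. (\<lambda>b. p @ [b]) `
      {b. last p \<lless> b \<and> scale (ghost (last p) b) (scale (ghost_path p) m0) \<noteq> \<zero>\<^bsub>M\<^esub>})"
  proof
    fix q assume q: "q \<in> forest (Suc n)"
    then obtain p b where pb: "q = p @ [b]" "length p = Suc n"
      by (auto simp: forest_def length_Suc_conv_rev)
    then have "p \<noteq> []" by auto
    then have p: "path p" "last p \<lless> b"
      using path_snoc[of p b] q pb by (auto simp: forest_def)
    have "scale (ghost_path q) m0 = scale (ghost (last p) b) (scale (ghost_path p) m0)"
      using scale_eqv[OF ghost_path_snoc[OF p]] p m0 pb by (simp add: scale_mult)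
    then have *: "scale (ghost (last p) b) (scale (ghost_path p) m0) \<noteq> \<zero>\<^bsub>M\<^esub>"
      using q by (simp add: forest_def)
    then have "p \<in> forest n"
      using p pb by (auto simp: forest_def)
    then show "q \<in> (\<Union>p\<in>forest n. (\<lambda>b. p @ [b]) `
      {b. last p \<lless> b \<and> scale (ghost (last p) b) (scale (ghost_path p) m0) \<noteq> \<zero>\<^bsub>M\<^esub>})"
      using p pb * by blast
  qed
  moreover have "finite (\<Union>p\<in>forest n. (\<lambda>b. p @ [b]) `
      {b. last p \<lless> b \<and> scale (ghost (last p) b) (scale (ghost_path p) m0) \<noteq> \<zero>\<^bsub>M\<^esub>})"
    using Suc.IH m0 by (intro finite_UN_I finite_imageI finite_branching) (auto simp: forest_def)
  ultimately show ?case by (rule finite_subset)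
qed

lemma scale_mspan_zero:
  assumes "y \<in> mspan W"
    and "\<And>q. path q \<Longrightarrow> last q \<in> W \<Longrightarrow> scale (ghost_path q) m0 = \<zero>\<^bsub>M\<^esub>"
  shows "scale y m0 = \<zero>\<^bsub>M\<^esub>"
  using assms(1)
proof (induction rule: mspan.induct)
  case (mspan_rel x)
  then show ?case using scale_eqv[of x 0] m0 by (simp add: eqv_zero_iff)
next
  case (mspan_monomial p q)
  then show ?case using assms(2)[of q] m0 by (simp add: scale_mult)
next
  case (mspan_add x y)
  then show ?case using m0 by (simp add: scale_add mspan_R)
next
  case (mspan_const x k)
  then show ?case using m0 by (simp add: scale_mult mspan_R)
qed

text \<open>
  The forest is countable, and by \<open>fixing_element\<close> it contains paths that end beyond any given
  vertex; so the ends of its paths form a countable cofinal set.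
\<close>

lemma forest_contradiction: False
proof -
  let ?C = "\<Union>n. last ` forest n"
  have "countable ?C" using finite_forest by (auto intro: countable_finite)
  moreover have "?C \<subseteq> Field \<kappa>" by (auto simp: forest_def path_last_Field)
  moreover have "\<exists>b\<in>?C. (a, b) \<in> \<kappa>" if a: "a \<in> Field \<kappa>" for a
  proof -
    obtain y where y: "y \<in> mspan {w. a \<lless> w}" "scale y m0 = m0"
      using fixing_element[OF a m0] by blast
    then obtain q where q: "path q" "a \<lless> last q" "scale (ghost_path q) m0 \<noteq> \<zero>\<^bsub>M\<^esub>"
      using scale_mspan_zero[OF y(1)] m0(2) by auto
    then have "q \<in> forest (length q - 1)" using path_nonempty[OF q(1)] by (simp add: forest_def)
    then show ?thesis using q(2) by (auto simp: less_def)
  qed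
  ultimately have "countable_cofinality \<kappa>"
    unfolding countable_cofinality_def by (intro exI[of _ ?C] conjI ballI)
  then show False using uncountable_cofinality by simp
qed

end

lemma simple_faithful_contradiction: False
proof -
  obtain r m where "r \<in> carrier U" "m \<in> carrier M" "r \<odot>\<^bsub>M\<^esub> m \<noteq> \<zero>\<^bsub>M\<^esub>"
    using simple by (auto simp: simple_left_module_def)
  then show False
    using forest_contradiction[of "r \<odot>\<^bsub>M\<^esub> m"] M.smult_closed by blast
qed

end

lemma not_primitive_U: "\<not> primitive_ring TYPE('m) U"
  using simple_faithful_contradiction unfolding primitive_ring_def by blast

end

section \<open>The cardinality of the ordinal is an isomorphism invariant\<close>

lemma UN_UN_finite_lepoll:
  assumes "infinite A" "\<And>a b. finite (G a b)"
  shows "(\<Union>a\<in>A. \<Union>b\<in>A. G a b) \<lesssim> A"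
proof -
  have refl: "(card_of A, card_of A) \<in> ordLeq" by (rule card_of_mono1) simp
  have "(card_of (G a b), card_of A) \<in> ordLeq" for a b
    using finite_lepoll_infinite[OF assms(1) assms(2)[of a b]]
    by (simp add: lepoll_def card_of_ordLeq[symmetric])
  then have "(card_of (\<Union>b\<in>A. G a b), card_of A) \<in> ordLeq" for a
    by (intro card_of_UNION_ordLeq_infinite[OF assms(1) refl]) auto
  then have "(card_of (\<Union>a\<in>A. \<Union>b\<in>A. G a b), card_of A) \<in> ordLeq"
    by (intro card_of_UNION_ordLeq_infinite[OF assms(1) refl]) auto
  then show ?thesis by (simp add: lepoll_def card_of_ordLeq[symmetric])
qed

lemma algebra_isomorphic_sym:
  assumes A: "unital_algebra A" and iso: "algebra_isomorphic A B"
  shows "algebra_isomorphic B A"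
proof -
  interpret unital_algebra A by fact
  obtain h where h: "h \<in> ring_iso A B"
    "\<And>k x. x \<in> carrier A \<Longrightarrow> h (k \<odot>\<^bsub>A\<^esub> x) = k \<odot>\<^bsub>B\<^esub> h x"
    using iso by (auto simp: algebra_isomorphic_def)
  let ?g = "inv_into (carrier A) h"
  have bij: "bij_betw h (carrier A) (carrier B)" using h(1) by (simp add: ring_iso_def)
  have "?g (k \<odot>\<^bsub>B\<^esub> y) = k \<odot>\<^bsub>A\<^esub> ?g y" if y: "y \<in> carrier B" for k y
  proof -
    obtain x where x: "x \<in> carrier A" "y = h x"
      using bij y unfolding bij_betw_def by blast
    have "?g (h x) = x" "?g (h (k \<odot>\<^bsub>A\<^esub> x)) = k \<odot>\<^bsub>A\<^esub> x"
      using bij x smult_closed by (simp_all add: bij_betw_def inv_into_f_f)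
    then show ?thesis using x h(2) by simp
  qed
  moreover have "?g \<in> ring_iso B A"
    using ring_iso_set_sym[OF ring_axioms h(1)] by simp
  ultimately show ?thesis unfolding algebra_isomorphic_def by blast
qed

lemma (in leavitt_ordinal) infinite_Field: "infinite (Field \<kappa>)"
proof
  assume "finite (Field \<kappa>)"
  obtain a where "a \<in> Field \<kappa>" using Field_nonempty .
  then show False using exists_above[of a "Field \<kappa>"] less_Field \<open>finite (Field \<kappa>)\<close> by metis
qed

text \<open>
  A variant of the comparison of dimensions: under an isomorphism, the image of each
  generator of the first algebra meets only finitely many vertices of the second one, and every
  vertex of the second one must be met.
\<close>

lemma iso_imp_lepoll:
  fixes \<kappa> :: "'a rel" and \<kappa>' :: "'b rel"
  assumes "leavitt_ordinal \<kappa>" "leavitt_ordinal \<kappa>'"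
    and iso: "algebra_isomorphic (unitization (leavitt_path_algebra TYPE('k::field) (ordinal_graph \<kappa>)))
      (unitization (leavitt_path_algebra TYPE('k) (ordinal_graph \<kappa>')))"
  shows "Field \<kappa>' \<lesssim> Field \<kappa>"
proof -
  interpret A: leavitt_ordinal \<kappa> "TYPE('k)" by fact
  interpret B: leavitt_ordinal \<kappa>' "TYPE('k)" by fact
  obtain h where h: "h \<in> ring_iso A.U B.U"
    "\<And>k x. x \<in> carrier A.U \<Longrightarrow> h (k \<odot>\<^bsub>A.U\<^esub> x) = k \<odot>\<^bsub>B.U\<^esub> h x"
    using iso unfolding algebra_isomorphic_def A.U_eq[symmetric] B.U_eq[symmetric] by auto
  note hom = ring_iso_memE(1-4)[OF h(1)]
  \<comment> \<open>The component of a polynomial in the nonunital algebra.\<close>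
  define ext where "ext y = y - const (const_term y)"
    for y :: "('b, 'b \<times> 'b) generator free_monoid \<Rightarrow>\<^sub>0 'k"
  have "\<exists>y\<in>B.R. h (A.proj (letter g)) = B.proj y" if "g \<in> generators A.E" for g
    using B.proj_surj[OF hom(1)[OF A.proj_closed[of "letter g"]]] that by auto
  then obtain im where im: "\<And>g. g \<in> generators A.E \<Longrightarrow> im g \<in> B.R"
    "\<And>g. g \<in> generators A.E \<Longrightarrow> h (A.proj (letter g)) = B.proj (im g)"
    by metis
  define F where "F g = {a \<in> Field \<kappa>'. \<not> B.eqv (B.vertex a * ext (im g)) 0}" for g
  have F: "finite (F g)" if "g \<in> generators A.E" for g
    unfolding F_def ext_def by (rule B.finite_vertices[OF B.mspan_Field[OF im(1)[OF that]]])
  \<comment> \<open>The vertices that the images of all generators avoid would be avoided by the whole image.\<close>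
  have "\<exists>g\<in>generators A.E. a \<in> F g" if a: "a \<in> Field \<kappa>'" for a
  proof (rule ccontr)
    assume "\<not> (\<exists>g\<in>generators A.E. a \<in> F g)"
    then have gen: "B.eqv (B.vertex a * ext (im g)) 0" if "g \<in> generators A.E" for g
      using that a by (auto simp: F_def)
    have all: "\<exists>y\<in>B.R. h (A.proj x) = B.proj y \<and> B.eqv (B.vertex a * ext y) 0" if "x \<in> A.R" for x
      using that
    proof (induction rule: unital_polys_induct)
      case one
      then show ?case
        using hom(4) by (intro bexI[of _ 1]) (auto simp: A.proj_one B.proj_one ext_def lookup_one)
    next
      case (add x x')
      then obtain y y' where y: "y \<in> B.R" "h (A.proj x) = B.proj y" "B.eqv (B.vertex a * ext y) 0"
        and y': "y' \<in> B.R" "h (A.proj x') = B.proj y'" "B.eqv (B.vertex a * ext y') 0"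
        by blast
      have "h (A.proj (x + x')) = B.proj (y + y')"
        using hom(3)[of "A.proj x" "A.proj x'"] add y y'
        by (simp add: A.proj_closed A.proj_add B.proj_add)
      moreover have "B.eqv (B.vertex a * ext (y + y')) 0"
        using B.eqv_add[OF y(3) y'(3)]
        by (simp add: ext_def lookup_add const_add[symmetric] algebra_simps)
      ultimately show ?case using y y' by blast
    next
      case (const k x)
      then obtain y where y: "y \<in> B.R" "h (A.proj x) = B.proj y" "B.eqv (B.vertex a * ext y) 0"
        by blast
      have "h (A.proj (const k * x)) = B.proj (const k * y)"
        using h(2)[of "A.proj x" k] const y by (simp add: A.proj_closed A.proj_smult B.proj_smult)
      moreover have "ext (const k * y) = const k * ext y"
        by (simp add: ext_def const_term_mult const_mult[symmetric] right_diff_distrib)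
      then have "B.eqv (B.vertex a * ext (const k * y)) 0"
        using B.eqv_const[OF y(3), of k] by (simp add: const_left_commute[of _ k])
      ultimately show ?case using y by blast
    next
      case (letter g x)
      then obtain y where y: "y \<in> B.R" "h (A.proj x) = B.proj y" "B.eqv (B.vertex a * ext y) 0"
        by blast
      let ?z = "im g"
      have z: "?z \<in> B.R" using im letter by blast
      have "h (A.proj (letter g * x)) = B.proj (?z * y)"
        using hom(2)[of "A.proj (letter g)" "A.proj x"] letter y im
        by (simp add: A.proj_closed A.proj_mult B.proj_mult)
      moreover have "ext (?z * y) = const (const_term ?z) * ext y + ext ?z * y"
        by (simp add: ext_def const_term_mult const_mult[symmetric]
            const_commute[of "const (const_term ?z)" "const_term y"] algebra_simps)
      then have "B.vertex a * ext (?z * y) =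
          const (const_term ?z) * (B.vertex a * ext y) + B.vertex a * ext ?z * y"
        by (simp add: distrib_left const_left_commute[of "B.vertex a"] mult.assoc)
      moreover have "B.eqv (const (const_term ?z) * (B.vertex a * ext y) + B.vertex a * ext ?z * y)
          (const (const_term ?z) * 0 + 0 * y)"
        by (intro B.eqv_add B.eqv_const B.eqv_mult_r y gen letter)
      ultimately show ?case using y z by (intro bexI[of _ "?z * y"]) auto
    qed
    have "B.proj (B.vertex a) \<in> h ` carrier A.U"
      using h(1) B.proj_closed a by (auto simp: ring_iso_def bij_betw_def)
    then obtain x where x: "x \<in> A.R" "h (A.proj x) = B.proj (B.vertex a)"
      by (auto simp: A.carrier_U)
    then obtain y where y: "y \<in> B.R" "B.proj (B.vertex a) = B.proj y" "B.eqv (B.vertex a * ext y) 0"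
      using all by metis
    then have eqv: "B.eqv (B.vertex a) y" using a by (simp add: B.proj_eq_iff)
    then have "ext y = y" using B.eqv_const_term by (fastforce simp: ext_def)
    have "B.eqv (B.vertex a) (B.vertex a * B.vertex a)"
      using B.vertex_vertex[OF a a] B.eqv_sym by simp
    also have "B.eqv \<dots> (B.vertex a * y)" using eqv a by (intro B.eqv_mult_l) auto
    also have "B.eqv \<dots> 0" using y(3) \<open>ext y = y\<close> by simp
    finally show False using B.vertex_nonzero by blast
  qed
  moreover define G where
    "G a b = \<Union> (F ` ({Vertex a, Edge (a, b), Ghost (a, b)} \<inter> generators A.E))" for a b
  ultimately have "Field \<kappa>' \<subseteq> (\<Union>a\<in>Field \<kappa>. \<Union>b\<in>Field \<kappa>. G a b)"
  proof (intro subsetI)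
    fix a assume "a \<in> Field \<kappa>'"
    then obtain g where g: "g \<in> generators A.E" "a \<in> F g"
      using \<open>\<And>a. a \<in> Field \<kappa>' \<Longrightarrow> \<exists>g\<in>generators A.E. a \<in> F g\<close> by blast
    from g(1) obtain c d where cd: "c \<in> Field \<kappa>" "d \<in> Field \<kappa>"
      "g \<in> {Vertex c, Edge (c, d), Ghost (c, d)}"
      by (cases rule: A.generators_cases) (auto dest: A.less_Field)
    then have "a \<in> G c d" using g unfolding G_def by blast
    then show "a \<in> (\<Union>a\<in>Field \<kappa>. \<Union>b\<in>Field \<kappa>. G a b)" using cd by blast
  qed
  then have "Field \<kappa>' \<lesssim> (\<Union>a\<in>Field \<kappa>. \<Union>b\<in>Field \<kappa>. G a b)"
    by (rule subset_imp_lepoll)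
  also have "\<dots> \<lesssim> Field \<kappa>"
    by (rule UN_UN_finite_lepoll[OF A.infinite_Field]) (auto simp: G_def intro: F)
  finally show ?thesis .
qed

section \<open>Unitizations for ordinals of uncountable cofinality\<close>

lemma leavitt_ordinal_properties:
  fixes \<kappa> :: "'a rel"
  assumes "Well_order \<kappa>" "uncountable_cofinality \<kappa>"
  shows "unital_algebra (unitization (leavitt_path_algebra TYPE('k::field) (ordinal_graph \<kappa>)))"
    and "prime_ring (unitization (leavitt_path_algebra TYPE('k) (ordinal_graph \<kappa>)))"
    and "\<not> primitive_ring TYPE('m) (unitization (leavitt_path_algebra TYPE('k) (ordinal_graph \<kappa>)))"
    and "von_neumann_regular (unitization (leavitt_path_algebra TYPE('k) (ordinal_graph \<kappa>)))"
proof -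
  interpret leavitt_ordinal \<kappa> "TYPE('k)" using assms by unfold_locales
  show "unital_algebra (unitization (leavitt_path_algebra TYPE('k) (ordinal_graph \<kappa>)))"
    and "prime_ring (unitization (leavitt_path_algebra TYPE('k) (ordinal_graph \<kappa>)))"
    and "\<not> primitive_ring TYPE('m) (unitization (leavitt_path_algebra TYPE('k) (ordinal_graph \<kappa>)))"
    and "von_neumann_regular (unitization (leavitt_path_algebra TYPE('k) (ordinal_graph \<kappa>)))"
    using unital_algebra_U prime_U not_primitive_U von_neumann_regular_U unfolding U_eq by blast+
qed

theorem theorem5p8:
  shows "(\<forall>\<kappa> :: 'a rel. Well_order \<kappa> \<and> uncountable_cofinality \<kappa> \<longrightarrow>
           (let R = unitization (leavitt_path_algebra TYPE('k::field) (ordinal_graph \<kappa>)) in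
             ring R \<and> prime_ring R \<and> \<not> primitive_ring TYPE('m) R \<and> von_neumann_regular R))
       \<and> (\<forall>(\<A> :: 'i set) (\<kappa> :: 'i \<Rightarrow> 'b rel).
           (\<forall>\<alpha>\<in>\<A>. Well_order (\<kappa> \<alpha>) \<and> uncountable (Field (\<kappa> \<alpha>)) \<and> uncountable_cofinality (\<kappa> \<alpha>)) \<and>
           (\<forall>\<alpha>\<in>\<A>. \<forall>\<beta>\<in>\<A>. \<alpha> \<noteq> \<beta> \<longrightarrow> \<not> Field (\<kappa> \<alpha>) \<approx> Field (\<kappa> \<beta>)) \<longrightarrow>
           (let R = (\<lambda>\<alpha>. unitization (leavitt_path_algebra TYPE(complex) (ordinal_graph (\<kappa> \<alpha>)))) in
             (\<forall>\<alpha>\<in>\<A>. unital_algebra (R \<alpha>) \<and> prime_ring (R \<alpha>) \<and>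
                \<not> primitive_ring TYPE('n) (R \<alpha>) \<and> von_neumann_regular (R \<alpha>)) \<and>
             (\<forall>\<alpha>\<in>\<A>. \<forall>\<beta>\<in>\<A>. \<alpha> \<noteq> \<beta> \<longrightarrow> \<not> algebra_isomorphic (R \<alpha>) (R \<beta>))))"
proof (intro conjI allI impI)
  fix \<kappa> :: "'a rel"
  assume "Well_order \<kappa> \<and> uncountable_cofinality \<kappa>"
  then show "let R = unitization (leavitt_path_algebra TYPE('k) (ordinal_graph \<kappa>)) in
      ring R \<and> prime_ring R \<and> \<not> primitive_ring TYPE('m) R \<and> von_neumann_regular R"
    using leavitt_ordinal_properties unital_algebra.axioms(1) unfolding Let_def by blast
next
  fix \<A> :: "'i set" and \<kappa> :: "'i \<Rightarrow> 'b rel"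
  assume *: "(\<forall>\<alpha>\<in>\<A>. Well_order (\<kappa> \<alpha>) \<and> uncountable (Field (\<kappa> \<alpha>)) \<and> uncountable_cofinality (\<kappa> \<alpha>)) \<and>
     (\<forall>\<alpha>\<in>\<A>. \<forall>\<beta>\<in>\<A>. \<alpha> \<noteq> \<beta> \<longrightarrow> \<not> Field (\<kappa> \<alpha>) \<approx> Field (\<kappa> \<beta>))"
  let ?R = "\<lambda>\<alpha>. unitization (leavitt_path_algebra TYPE(complex) (ordinal_graph (\<kappa> \<alpha>)))"
  have alg: "unital_algebra (?R \<alpha>)" "prime_ring (?R \<alpha>)" "\<not> primitive_ring TYPE('n) (?R \<alpha>)"
    "von_neumann_regular (?R \<alpha>)" if "\<alpha> \<in> \<A>" for \<alpha>
    using leavitt_ordinal_properties[of "\<kappa> \<alpha>"] * that by auto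
  have "\<not> algebra_isomorphic (?R \<alpha>) (?R \<beta>)" if ab: "\<alpha> \<in> \<A>" "\<beta> \<in> \<A>" "\<alpha> \<noteq> \<beta>" for \<alpha> \<beta>
  proof
    assume iso: "algebra_isomorphic (?R \<alpha>) (?R \<beta>)"
    have "leavitt_ordinal (\<kappa> \<alpha>)" "leavitt_ordinal (\<kappa> \<beta>)"
      using * ab by (auto simp: leavitt_ordinal_def)
    then have "Field (\<kappa> \<beta>) \<lesssim> Field (\<kappa> \<alpha>)" "Field (\<kappa> \<alpha>) \<lesssim> Field (\<kappa> \<beta>)"
      using iso_imp_lepoll iso algebra_isomorphic_sym[OF alg(1)[OF ab(1)] iso] by blast+
    then show False using lepoll_antisym * ab by blast
  qed
  then show "let R = ?R in
      (\<forall>\<alpha>\<in>\<A>. unital_algebra (R \<alpha>) \<and> prime_ring (R \<alpha>) \<and>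
         \<not> primitive_ring TYPE('n) (R \<alpha>) \<and> von_neumann_regular (R \<alpha>)) \<and>
      (\<forall>\<alpha>\<in>\<A>. \<forall>\<beta>\<in>\<A>. \<alpha> \<noteq> \<beta> \<longrightarrow> \<not> algebra_isomorphic (R \<alpha>) (R \<beta>))"
    using alg unfolding Let_def by blast
qed

end
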